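(* Let $k$ be a field and $n\ge3$. For every $i$ with $0\le i\le n-1$, the field $L_{\mathbf s}L_{\mathbf t}$ is generated over $K$ by all conjugates of $u_i$: $L_{\mathbf s}L_{\mathbf t}=K(u_i^g\mid \overline g\in H\backslash G_{\mathbf s,\mathbf t})$.
   Context: Let $x_1,\ldots,x_n,y_1,\ldots,y_n$ be independent variables over $k$; let $s_i$ (resp. $t_i$) be the $i$-th elementary symmetric function of $\mathbf x=(x_1,\ldots,x_n)$ (resp. $\mathbf y=(y_1,\ldots,y_n)$). Put $K=k(s_1,\ldots,s_n,t_1,\ldots,t_n)$, $L_{\mathbf s}=K(x_1,\ldots,x_n)$, $L_{\mathbf t}=K(y_1,\ldots,y_n)$, so $L_{\mathbf s}L_{\mathbf t}=k(\mathbf x,\mathbf y)$. Let $G_{\mathbf s,\mathbf t}=\mathrm{Gal}(k(\mathbf x,\mathbf y)/K)\cong\mathfrak S_n\times\mathfrak S_n$, which acts by permuting the $x_i$ and, independently, the $y_i$; the action is written on the right, $a\mapsto a^g$, with $a^{gh}=(a^g)^h$. Let $H\subset G_{\mathbf s,\mathbf t}$ be the diagonal subgroup of those $g$ for which there is $\pi\in\mathfrak S_n$ with $x_i^g=x_{\pi(i)}$ and $y_i^g=y_{\pi(i)}$ for all $i$. Define $u_0,\ldots,u_{n-1}\in k(\mathbf x,\mathbf y)$ as the unique solution of the system $y_i=u_0+u_1x_i+\cdots+u_{n-1}x_i^{n-1}$ ($i=1,\ldots,n$). Each $u_i$ is fixed by $H$, so $u_i^g$ depends only on the right coset $\overline g=Hg$.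 *)

theory Defs
  imports
    "HOL-Library.Poly_Mapping"
    "HOL-Computational_Algebra.Fraction_Field"
    "HOL-Combinatorics.Permutations"
    "HOL-Algebra.Algebraic_Closure_Type"
    "HOL-Algebra.Bij"
    "HOL-Algebra.Generated_Fields"
    "HOL-Algebra.Coset"
begin

text \<open>
  The variables live in the field of rational functions over \<open>k\<close> (the type \<open>'k\<close>) in the
  variables \<open>X\<^sub>0, X\<^sub>1, X\<^sub>2, \<dots>\<close>: the fraction field of the ring of finitely supported functions
  from monomials to \<open>k\<close>. It serves as an ambient field for every \<open>n\<close>; the field
  \<open>k(x\<^sub>1, \<dots>, x\<^sub>n, y\<^sub>1, \<dots>, y\<^sub>n)\<close> is the subfield \<open>kxy n\<close> below.
\<close>

type_synonym 'k ratfun = "((nat \<Rightarrow>\<^sub>0 nat) \<Rightarrow>\<^sub>0 'k) fract"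

abbreviation ambient :: "'k::field ratfun ring" where
  "ambient \<equiv> ring_of_type_algebra"

definition emb :: "'k::field \<Rightarrow> 'k ratfun" where
  "emb c = Fract (Poly_Mapping.single 0 c) 1"

definition var :: "nat \<Rightarrow> 'k::field ratfun" where
  "var m = Fract (Poly_Mapping.single (Poly_Mapping.single m 1) 1) 1"

text \<open>Even and odd indices keep the two families of variables disjoint.\<close>

definition xvar :: "nat \<Rightarrow> 'k::field ratfun" where "xvar i = var (2 * i)"
definition yvar :: "nat \<Rightarrow> 'k::field ratfun" where "yvar i = var (2 * i + 1)"

definition elem_sym :: "nat \<Rightarrow> (nat \<Rightarrow> 'a::comm_ring_1) \<Rightarrow> nat \<Rightarrow> 'a" where
  "elem_sym n z i = (\<Sum>A | A \<subseteq> {1..n} \<and> card A = i. \<Prod>j\<in>A. z j)"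

definition s_sym :: "nat \<Rightarrow> nat \<Rightarrow> 'k::field ratfun" where "s_sym n = elem_sym n xvar"
definition t_sym :: "nat \<Rightarrow> nat \<Rightarrow> 'k::field ratfun" where "t_sym n = elem_sym n yvar"

definition adjoin :: "'k::field ratfun set \<Rightarrow> 'k ratfun set \<Rightarrow> 'k ratfun set" where
  "adjoin F S = generate_field ambient (F \<union> S)"

definition K_st :: "nat \<Rightarrow> 'k::field ratfun set" where
  "K_st n = adjoin (range emb) (s_sym n ` {1..n} \<union> t_sym n ` {1..n})"

definition L_s :: "nat \<Rightarrow> 'k::field ratfun set" where "L_s n = adjoin (K_st n) (xvar ` {1..n})"
definition L_t :: "nat \<Rightarrow> 'k::field ratfun set" where "L_t n = adjoin (K_st n) (yvar ` {1..n})"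

definition kxy :: "nat \<Rightarrow> 'k::field ratfun set" where
  "kxy n = adjoin (range emb) (xvar ` {1..n} \<union> yvar ` {1..n})"

text \<open>
  The Galois group of \<open>kxy n\<close> over \<open>K_st n\<close>. Automorphisms are functions restricted to \<open>kxy n\<close>, so
  that they are equal when they agree there. The action is on the right: \<open>a\<^sup>g\<close> is \<open>g a\<close>, and in the
  product \<open>gh\<close> the map \<open>g\<close> is applied first.
\<close>

definition Gal :: "nat \<Rightarrow> ('k::field ratfun \<Rightarrow> 'k ratfun) monoid" where
  "Gal n =
    \<lparr>carrier = {g \<in> Bij (kxy n).
        g \<in> ring_iso (ambient\<lparr>carrier := kxy n\<rparr>) (ambient\<lparr>carrier := kxy n\<rparr>) \<and>
        (\<forall>a\<in>K_st n. g a = a)},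
     monoid.mult = \<lambda>g h. compose (kxy n) h g,
     one = \<lambda>a\<in>kxy n. a\<rparr>"

definition Hdiag :: "nat \<Rightarrow> ('k::field ratfun \<Rightarrow> 'k ratfun) set" where
  "Hdiag n = {g \<in> carrier (Gal n).
     \<exists>\<pi>. \<pi> permutes {1..n} \<and> (\<forall>i\<in>{1..n}. g (xvar i) = xvar (\<pi> i) \<and> g (yvar i) = yvar (\<pi> i))}"

text \<open>
  The coefficients \<open>u\<^sub>0, \<dots>, u\<^sub>n\<^sub>-\<^sub>1\<close>; the value \<open>0\<close> at indices \<open>j \<ge> n\<close> only serves to make the
  function unique.
\<close>

definition is_u :: "nat \<Rightarrow> (nat \<Rightarrow> 'k::field ratfun) \<Rightarrow> bool" where
  "is_u n v \<longleftrightarrow>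
     (\<forall>j<n. v j \<in> kxy n) \<and> (\<forall>j\<ge>n. v j = 0) \<and>
     (\<forall>i\<in>{1..n}. yvar i = (\<Sum>j<n. v j * xvar i ^ j))"

definition u_coeff :: "nat \<Rightarrow> nat \<Rightarrow> 'k::field ratfun" where
  "u_coeff n = (THE v. is_u n v)"

definition conjugates :: "nat \<Rightarrow> 'k::field ratfun \<Rightarrow> 'k ratfun set" where
  "conjugates n a = {g a | g C. C \<in> rcosets\<^bsub>Gal n\<^esub> (Hdiag n) \<and> g \<in> C}"


subsection \<open>The definitions make sense\<close>

lemma ambient_simps [simp]:
  fixes a b :: "'k::field ratfun"
  shows "carrier (ambient :: 'k ratfun ring) = UNIV"
    "a \<otimes>\<^bsub>ambient\<^esub> b = a * b" "a \<oplus>\<^bsub>ambient\<^esub> b = a + b"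
    "\<one>\<^bsub>ambient\<^esub> = (1 :: 'k ratfun)" "\<zero>\<^bsub>ambient\<^esub> = (0 :: 'k ratfun)"
  by (simp_all add: ring_of_type_algebra_def)

lemma field_ambient: "field (ambient :: 'k::field ratfun ring)"
  by (rule field_from_type_algebra)

lemma cring_ambient: "cring (ambient :: 'k::field ratfun ring)"
  by (rule cring_from_type_algebra)

lemma ambient_uminus [simp]: "\<ominus>\<^bsub>ambient\<^esub> a = - (a :: 'k::field ratfun)"
  by (rule abelian_group.minus_equality)
    (auto intro: cring_ambient cring.axioms ring.is_abelian_group)

lemma ambient_inv:
  assumes "a \<noteq> 0"
  shows "inv\<^bsub>ambient\<^esub> a = inverse (a :: 'k::field ratfun)"
proof -
  have "comm_monoid (ambient :: 'k ratfun ring)"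
    using cring_ambient cring.axioms by blast
  then show ?thesis
    using assms by (intro comm_monoid.comm_inv_char) auto
qed

lemma subfield_adjoin: "subfield (adjoin F S) (ambient :: 'k::field ratfun ring)"
  unfolding adjoin_def by (rule field.generate_field_is_subfield[OF field_ambient]) simp

lemma adjoin_incl: "F \<subseteq> adjoin F S" "S \<subseteq> adjoin F S"
  unfolding adjoin_def by (auto intro: generate_field.incl)

lemma adjoin_least:
  assumes "F \<union> S \<subseteq> adjoin F' S'"
  shows "adjoin F S \<subseteq> adjoin F' S'"
  using field.generate_field_min_subfield1[OF field_ambient _ subfield_adjoin assms]
  by (simp add: adjoin_def)

lemma adjoin_closed:
  fixes a b :: "'k::field ratfun"
  shows "0 \<in> adjoin F S" "1 \<in> adjoin F S"
    "a \<in> adjoin F S \<Longrightarrow> b \<in> adjoin F S \<Longrightarrow> a + b \<in> adjoin F S"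
    "a \<in> adjoin F S \<Longrightarrow> b \<in> adjoin F S \<Longrightarrow> a * b \<in> adjoin F S"
    "a \<in> adjoin F S \<Longrightarrow> - a \<in> adjoin F S"
    "a \<in> adjoin F S \<Longrightarrow> inverse a \<in> adjoin F S"
proof -
  note * = generate_field.intros[where R = ambient and H = "F \<union> S"]
  show "0 \<in> adjoin F S"
    using field.zero_in_generate[OF field_ambient, of "F \<union> S"] by (simp add: adjoin_def)
  then show "a \<in> adjoin F S \<Longrightarrow> inverse a \<in> adjoin F S"
    using *(4)[where h = a] by (cases "a = 0") (auto simp: adjoin_def ambient_inv)
qed (use generate_field.intros[where R = ambient and H = "F \<union> S"] in \<open>auto simp: adjoin_def\<close>)

lemma adjoin_sum:
  "(\<And>j. j \<in> A \<Longrightarrow> f j \<in> adjoin F S) \<Longrightarrow> sum f A \<in> adjoin F (S :: 'k::field ratfun set)"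
  by (induction A rule: infinite_finite_induct) (auto intro: adjoin_closed)

lemma adjoin_prod:
  "(\<And>j. j \<in> A \<Longrightarrow> f j \<in> adjoin F S) \<Longrightarrow> prod f A \<in> adjoin F (S :: 'k::field ratfun set)"
  by (induction A rule: infinite_finite_induct) (auto intro: adjoin_closed)

lemma kxy_mem:
  fixes c :: "'k::field"
  shows "emb c \<in> kxy n"
    and "i \<in> {1..n} \<Longrightarrow> xvar i \<in> (kxy n :: 'k ratfun set)"
    and "i \<in> {1..n} \<Longrightarrow> yvar i \<in> (kxy n :: 'k ratfun set)"
  using adjoin_incl[where F = "range emb :: 'k ratfun set" and S = "xvar ` {1..n} \<union> yvar ` {1..n}"]
  by (auto simp: kxy_def)

lemma K_st_le_kxy: "K_st n \<subseteq> (kxy n :: 'k::field ratfun set)"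
proof -
  have *: "elem_sym n z i \<in> kxy n" if "\<forall>j\<in>{1..n}. z j \<in> kxy n"
    for z :: "nat \<Rightarrow> 'k ratfun" and i
    using that unfolding elem_sym_def kxy_def
    by (intro adjoin_sum adjoin_prod) (auto simp: subset_iff)
  then have "range emb \<union> (s_sym n ` {1..n} \<union> t_sym n ` {1..n}) \<subseteq> (kxy n :: 'k ratfun set)"
    using kxy_mem[where 'k = 'k and n = n] by (auto simp: s_sym_def t_sym_def intro!: *)
  then show ?thesis
    unfolding K_st_def kxy_def by (rule adjoin_least)
qed

lemma L_s_le_kxy: "L_s n \<subseteq> (kxy n :: 'k::field ratfun set)"
  unfolding L_s_def kxy_def
proof (rule adjoin_least)
  show "K_st n \<union> xvar ` {1..n} \<subseteq> adjoin (range emb :: 'k ratfun set) (xvar ` {1..n} \<union> yvar ` {1..n})"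
    using K_st_le_kxy[of n] kxy_mem(2)[where 'k = 'k and n = n] unfolding kxy_def by blast
qed

lemma L_t_le_kxy: "L_t n \<subseteq> (kxy n :: 'k::field ratfun set)"
  unfolding L_t_def kxy_def
proof (rule adjoin_least)
  show "K_st n \<union> yvar ` {1..n} \<subseteq> adjoin (range emb :: 'k ratfun set) (xvar ` {1..n} \<union> yvar ` {1..n})"
    using K_st_le_kxy[of n] kxy_mem(3)[where 'k = 'k and n = n] unfolding kxy_def by blast
qed

lemma generators_in_L: "range emb \<subseteq> (L_s n :: 'k::field ratfun set)" "xvar ` {1..n} \<subseteq> (L_s n :: 'k ratfun set)"
    "yvar ` {1..n} \<subseteq> (L_t n :: 'k ratfun set)"
  unfolding L_s_def L_t_def K_st_def
  by (rule order_trans[OF adjoin_incl(1) adjoin_incl(1)] adjoin_incl(2))+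

lemma compositum_eq_kxy:
  "adjoin (L_s n) (L_t n) = (kxy n :: 'k::field ratfun set)"
proof
  have "L_s n \<union> L_t n \<subseteq> adjoin (range emb :: 'k ratfun set) (xvar ` {1..n} \<union> yvar ` {1..n})"
    using L_s_le_kxy L_t_le_kxy unfolding kxy_def by (rule Un_least)
  then show "adjoin (L_s n) (L_t n) \<subseteq> (kxy n :: 'k ratfun set)"
    unfolding kxy_def by (rule adjoin_least)
  have "range emb \<union> (xvar ` {1..n} \<union> yvar ` {1..n}) \<subseteq> (adjoin (L_s n) (L_t n) :: 'k ratfun set)"
    by (intro Un_least order_trans[OF generators_in_L(1) adjoin_incl(1)] order_trans[OF generators_in_L(2) adjoin_incl(1)]
      order_trans[OF generators_in_L(3) adjoin_incl(2)])
  then show "kxy n \<subseteq> (adjoin (L_s n) (L_t n) :: 'k ratfun set)"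
    unfolding kxy_def by (rule adjoin_least)
qed

lemma group_Gal: "group (Gal n :: ('k::field ratfun \<Rightarrow> _) monoid)"
proof -
  let ?L = "kxy n :: 'k ratfun set"
  let ?G = "Gal n :: ('k ratfun \<Rightarrow> 'k ratfun) monoid"
  have C: "0 \<in> ?L" "1 \<in> ?L" "\<And>a b. a \<in> ?L \<Longrightarrow> b \<in> ?L \<Longrightarrow> a + b \<in> ?L"
    "\<And>a b. a \<in> ?L \<Longrightarrow> b \<in> ?L \<Longrightarrow> a * b \<in> ?L"
    unfolding kxy_def by (auto intro: adjoin_closed)
  have KL: "a \<in> ?L" if "a \<in> K_st n" for a using that K_st_le_kxy by blast
  have mem: "g \<in> carrier ?G \<longleftrightarrow> g \<in> Bij ?L \<and> (\<forall>a\<in>?L. \<forall>b\<in>?L. g (a * b) = g a * g b) \<and>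
      (\<forall>a\<in>?L. \<forall>b\<in>?L. g (a + b) = g a + g b) \<and> g 1 = 1 \<and> (\<forall>a\<in>K_st n. g a = a)" for g
    by (auto simp: Gal_def ring_iso_def ring_hom_def Bij_def bij_betw_def)
  have closed: "g a \<in> ?L" if "g \<in> Bij ?L" "a \<in> ?L" for g a
    using that by (auto simp: Bij_def bij_betw_def)
  show ?thesis
  proof (rule groupI)
    fix g h assume gh: "g \<in> carrier ?G" "h \<in> carrier ?G"
    show "g \<otimes>\<^bsub>?G\<^esub> h \<in> carrier ?G"
      using gh compose_Bij[of h ?L g] unfolding mem
      by (auto simp: Gal_def compose_def closed C KL)
  next
    show "\<one>\<^bsub>?G\<^esub> \<in> carrier ?G"
      unfolding mem using id_Bij[of ?L] by (auto simp: Gal_def C KL)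
  next
    fix f g h
    assume "f \<in> carrier ?G" "g \<in> carrier ?G" "h \<in> carrier ?G"
    then have "f \<in> ?L \<rightarrow> ?L" unfolding mem using Bij_imp_funcset by blast
    then show "f \<otimes>\<^bsub>?G\<^esub> g \<otimes>\<^bsub>?G\<^esub> h = f \<otimes>\<^bsub>?G\<^esub> (g \<otimes>\<^bsub>?G\<^esub> h)"
      by (simp add: Gal_def compose_assoc)
  next
    fix g assume g: "g \<in> carrier ?G"
    then have gB: "g \<in> Bij ?L" by (simp add: mem)
    then show "\<one>\<^bsub>?G\<^esub> \<otimes>\<^bsub>?G\<^esub> g = g"
      by (auto simp: Gal_def compose_def Bij_def extensional_def)
    let ?h = "restrict (inv_into ?L g) ?L"
    have hB: "?h \<in> Bij ?L" by (rule restrict_inv_into_Bij[OF gB])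
    have inj: "inj_on g ?L" using gB by (auto simp: Bij_def bij_betw_def)
    have gh: "g (?h a) = a" if "a \<in> ?L" for a
      using that gB by (auto simp: Bij_def bij_betw_def f_inv_into_f)
    have hc: "?h a \<in> ?L" if "a \<in> ?L" for a using closed[OF hB that] .
    have eq: "?h a = b" if "a \<in> ?L" "b \<in> ?L" "g b = a" for a b
      using inj_onD[OF inj _ hc[OF that(1)] that(2)] gh[OF that(1)] that(3) by simp
    have "?h \<in> carrier ?G"
      unfolding mem
    proof (intro conjI ballI hB)
      fix a b assume ab: "a \<in> ?L" "b \<in> ?L"
      show "?h (a * b) = ?h a * ?h b"
        using g ab gh hc unfolding mem by (intro eq C hc) simp_all
      show "?h (a + b) = ?h a + ?h b"
        using g ab gh hc unfolding mem by (intro eq C hc) simp_all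
    next
      show "?h 1 = 1" using g unfolding mem by (intro eq C) simp
    next
      fix a :: "'k ratfun" assume "a \<in> K_st n"
      then show "?h a = a" using g unfolding mem by (intro eq KL) simp_all
    qed
    moreover have "?h \<otimes>\<^bsub>?G\<^esub> g = \<one>\<^bsub>?G\<^esub>"
      using gh by (auto simp: Gal_def compose_def fun_eq_iff)
    ultimately show "\<exists>h\<in>carrier ?G. h \<otimes>\<^bsub>?G\<^esub> g = \<one>\<^bsub>?G\<^esub>" by blast
  qed
qed

lemma xvar_eq_iff: "(xvar i :: 'k::field ratfun) = xvar j \<longleftrightarrow> i = j"
proof
  assume "(xvar i :: 'k ratfun) = xvar j"
  then have "Poly_Mapping.single (Poly_Mapping.single (2*i) (1::nat)) (1::'k) =
      Poly_Mapping.single (Poly_Mapping.single (2*j) 1) 1"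
    by (simp add: xvar_def var_def eq_fract)
  then have "Poly_Mapping.keys (Poly_Mapping.single (Poly_Mapping.single (2*i) (1::nat)) (1::'k)) =
      Poly_Mapping.keys (Poly_Mapping.single (Poly_Mapping.single (2*j) (1::nat)) (1::'k))" by simp
  then have "Poly_Mapping.keys (Poly_Mapping.single (2*i) (1::nat)) =
      Poly_Mapping.keys (Poly_Mapping.single (2*j) (1::nat))" by simp
  then show "i = j" by simp
qed simp

lemma ex1_is_u: "\<exists>!v :: nat \<Rightarrow> 'k::field ratfun. is_u n v"
proof -
  let ?L = "kxy n :: 'k ratfun set"
  have pin: "\<forall>m. coeff (\<Sum>i\<in>A. f i) m \<in> ?L" if "\<And>i m. i \<in> A \<Longrightarrow> coeff (f i) m \<in> ?L"
    for A :: "nat set" and f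
    using that unfolding kxy_def by (auto simp: coeff_sum intro: adjoin_sum)
  have pmul: "coeff (p * q) m \<in> ?L" if "\<And>m. coeff p m \<in> ?L" "\<And>m. coeff q m \<in> ?L" for p q m
    using that unfolding kxy_def coeff_mult by (intro adjoin_sum adjoin_closed)
  have pprod: "\<forall>m. coeff (\<Prod>i\<in>A. f i) m \<in> ?L" if "\<And>i m. i \<in> A \<Longrightarrow> coeff (f i) m \<in> ?L"
    for A :: "nat set" and f
    using that
  proof (induction A rule: infinite_finite_induct)
    case (insert a A)
    then show ?case by (auto intro: pmul)
  qed (auto simp: kxy_def coeff_1 intro: adjoin_closed)
  have evalp: "(\<Sum>j<n. coeff p j * c ^ j) = poly p c" if "\<And>j. j \<ge> n \<Longrightarrow> coeff p j = 0"
    for p :: "'k ratfun poly" and c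
  proof -
    have "poly p c = (\<Sum>j\<le>degree p. coeff p j * c ^ j)" by (rule poly_altdef)
    also have "\<dots> = (\<Sum>j<n. coeff p j * c ^ j)"
    proof (rule sum.mono_neutral_cong)
    qed (use that in \<open>auto simp: not_less not_le coeff_eq_0\<close>)
    finally show ?thesis by simp
  qed
  define l where "l i = smult (yvar i / (\<Prod>j\<in>{1..n}-{i}. xvar i - xvar j))
      (\<Prod>j\<in>{1..n}-{i}. [:- xvar j, 1:] :: 'k ratfun poly)" for i
  define p where "p = (\<Sum>i=1..n. l i)"
  have l_mem: "coeff (l i) m \<in> ?L" if "i \<in> {1..n}" for i m
  proof -
    have d: "(\<Prod>j\<in>{1..n}-{i}. xvar i - xvar j) \<in> ?L"
      using kxy_mem(2)[where 'k = 'k and n = n] that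
      unfolding kxy_def diff_conv_add_uminus by (intro adjoin_prod adjoin_closed) auto
    have q: "\<forall>m. coeff (\<Prod>j\<in>{1..n}-{i}. [:- xvar j, 1:] :: 'k ratfun poly) m \<in> ?L"
      by (rule pprod)
        (use kxy_mem(2)[where 'k = 'k and n = n] in
          \<open>auto simp: kxy_def coeff_pCons coeff_1 intro!: adjoin_closed split: nat.split\<close>)
    show ?thesis
      using d q kxy_mem(3)[OF that] unfolding l_def coeff_smult divide_inverse kxy_def
      by (intro adjoin_closed) auto
  qed
  have l_deg: "coeff (l i) m = 0" if "i \<in> {1..n}" "m \<ge> n" for i m
  proof -
    have "degree (\<Prod>j\<in>{1..n}-{i}. [:- xvar j, 1:] :: 'k ratfun poly) \<le>
        sum (degree \<circ> (\<lambda>j. [:- xvar j, 1:] :: 'k ratfun poly)) ({1..n}-{i})"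
      by (rule degree_prod_sum_le) simp
    also have "\<dots> = n - 1" using that by simp
    finally have "degree (l i) \<le> n - 1"
      unfolding l_def using degree_smult_le order_trans by blast
    then show ?thesis using that by (intro coeff_eq_0) auto
  qed
  have l_eval: "poly (l i) (xvar m) = (if i = m then yvar i else 0)"
    if "i \<in> {1..n}" "m \<in> {1..n}" for i m
    using that by (auto simp: l_def poly_prod xvar_eq_iff)
  have p_eval: "poly p (xvar m) = yvar m" if "m \<in> {1..n}" for m
    unfolding p_def poly_sum using that by (simp add: l_eval)
  have p0: "coeff p j = 0" if "j \<ge> n" for j
    unfolding p_def coeff_sum using that by (simp add: l_deg)
  have ex: "is_u n (coeff p)"
    unfolding is_u_def using pin[of "{1..n}" l] l_mem p0 evalp[of p, OF p0] p_eval
    unfolding p_def[symmetric] by auto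
  have "v = coeff p" if v: "is_u n v" for v
  proof -
    define q where "q = (\<Sum>j<n. monom (v j) j)"
    have cq: "coeff q j = v j" for j
      using v by (auto simp: q_def coeff_sum is_u_def not_less)
    have "q - p = 0"
    proof (rule ccontr)
      assume nz: "q - p \<noteq> 0"
      have "n > 0"
      proof (rule ccontr)
        assume "\<not> n > 0"
        then have "coeff (q - p) j = 0" for j
          using v by (simp add: cq p0 is_u_def)
        then show False using nz by (auto simp: poly_eq_iff)
      qed
      have "degree (q - p) \<le> n - 1"
        by (rule degree_le) (use v in \<open>auto simp: cq p0 is_u_def\<close>)
      moreover have "xvar ` {1..n} \<subseteq> {c. poly (q - p) c = 0}"
      proof
        fix c :: "'k ratfun" assume "c \<in> xvar ` {1..n}"
        then obtain m where m: "m \<in> {1..n}" "c = xvar m" by auto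
        have "poly q c = yvar m"
          using v m evalp[of q c] by (auto simp: cq is_u_def)
        then show "c \<in> {c. poly (q - p) c = 0}" using p_eval m by simp
      qed
      then have "card (xvar ` {1..n} :: 'k ratfun set) \<le> card {c. poly (q - p) c = 0}"
        by (intro card_mono poly_roots_finite nz)
      then have "n \<le> card {c. poly (q - p) c = 0}"
        by (simp add: card_image inj_on_def xvar_eq_iff)
      moreover have "card {c. poly (q - p) c = 0} \<le> degree (q - p)"
        by (rule card_poly_roots_bound[OF nz])
      ultimately show False using \<open>n > 0\<close> by linarith
    qed
    then show ?thesis using cq by (auto simp: fun_eq_iff)
  qed
  with ex show ?thesis by blast
qed

lemma is_u_u_coeff: "is_u n (u_coeff n)"
  unfolding u_coeff_def by (rule theI'[OF ex1_is_u])

end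

theory Submission
  imports Defs "HOL-Computational_Algebra.Polynomial_Factorial"
begin

text \<open>
  Let \<open>c\<^sub>p\<close> be the \<open>i\<close>-th coefficient of the Lagrange basis polynomial at \<open>x\<^sub>p\<close>, so that
  \<open>u\<^sub>i = \<Sum>\<^sub>m y\<^sub>m c\<^sub>m\<close>, and let \<open>M\<close> be the field generated over \<open>K\<close> by the conjugates. No Galois
  correspondence is needed: subtracting two conjugates that differ by a transposition gives
  \<open>(c\<^sub>p - c\<^sub>q) (y\<^sub>a - y\<^sub>b) \<in> M\<close>, and summing over \<open>b\<close> shows that all
  \<open>\<rho>\<^sub>j = (y\<^sub>a - y\<^sub>j) / (n y\<^sub>a - t\<^sub>1)\<close> lie in \<open>M\<close>. If \<open>T\<close> is the polynomial with roots
  \<open>y\<^sub>1, \<dots>, y\<^sub>n\<close>, then \<open>y\<^sub>a\<close> is the only common root of \<open>T(Y)\<close> and of the polynomials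
  \<open>T(Y - \<rho>\<^sub>j (n Y - t\<^sub>1))\<close> over \<open>M\<close>, so \<open>y\<^sub>a \<in> M\<close>, in every characteristic. Then the differences
  \<open>c\<^sub>p - c\<^sub>q\<close> and, as \<open>t\<^sub>1 \<noteq> 0\<close>, the \<open>c\<^sub>p\<close> themselves lie in \<open>M\<close>. Finally, with \<open>S\<close> the
  polynomial with roots \<open>x\<^sub>1, \<dots>, x\<^sub>n\<close>, there is \<open>E\<close> over \<open>K\<close> with \<open>E(x\<^sub>q) = c\<^sub>q S'(x\<^sub>q)\<close> for
  all \<open>q\<close>; as the \<open>c\<^sub>q\<close> are distinct for \<open>n \<ge> 3\<close>, \<open>x\<^sub>p\<close> is the only common root of \<open>S\<close> and
  \<open>E - c\<^sub>p S'\<close>, so \<open>x\<^sub>p \<in> M\<close>.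
\<close>

subsection \<open>Polynomials over a subfield\<close>

text \<open>Evaluating an equation \<open>[:- z b, 1:] * R' = P * W\<close> at \<open>z b\<close>
  forces the root onto \<open>W\<close>, since \<open>P\<close> does not vanish there; the linear
  factor then divides \<open>W\<close> and cancels on both sides.\<close>

lemma dvd_cancel_linear_factors:
  fixes P R :: "'a::field poly"
  assumes "finite B" "P dvd (\<Prod>b\<in>B. [:- z b, 1:]) * R" "\<And>b. b \<in> B \<Longrightarrow> poly P (z b) \<noteq> 0"
  shows "P dvd R"
  using assms
proof (induction B)
  case (insert b B)
  let ?R = "(\<Prod>b\<in>B. [:- z b, 1:]) * R"
  have "P dvd [:- z b, 1:] * ?R"
    using insert.prems(1) unfolding prod.insert[OF insert.hyps] mult.assoc .
  then obtain W where W: "[:- z b, 1:] * ?R = P * W" by (rule dvdE)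
  have "poly (P * W) (z b) = 0"
    unfolding W[symmetric] by simp
  then have "poly W (z b) = 0"
    using insert.prems(2)[of b] by simp
  then obtain W' where "W = [:- z b, 1:] * W'"
    by (auto simp: poly_eq_0_iff_dvd elim: dvdE)
  with W have "[:- z b, 1:] * ?R = [:- z b, 1:] * (P * W')"
    by (simp only: mult.left_commute)
  then have "?R = P * W'"
    by (subst (asm) mult_cancel_left) simp
  then have "P dvd ?R" by (rule dvdI)
  then show ?case
    using insert.IH insert.prems(2) by simp
qed simp

text \<open>The polynomial with coefficients \<open>w\<close> and the Lagrange interpolant have
  degree at most \<open>n - 1\<close> and agree at \<open>n\<close> points, so they coincide. This
  turns each \<open>u_i\<close> into a linear form in the \<open>y\<close> variables.\<close>

lemma Lagrange_interpolation_coeff: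
  fixes x z w :: "nat \<Rightarrow> 'a::field"
  assumes inj: "inj_on x A" and A: "finite A" "card A = n"
    and z: "\<And>m. m \<in> A \<Longrightarrow> z m = (\<Sum>j<n. w j * x m ^ j)" and i: "i < n"
  shows "w i = (\<Sum>m\<in>A. z m * (coeff (\<Prod>j\<in>A-{m}. [:- x j, 1:]) i / (\<Prod>j\<in>A-{m}. x m - x j)))"
proof -
  define p where "p = (\<Sum>j<n. monom (w j) j)"
  define l where "l m = (\<Prod>j\<in>A-{m}. [:- x j, 1:])" for m
  define d where "d m = (\<Prod>j\<in>A-{m}. x m - x j)" for m
  define q where "q = (\<Sum>m\<in>A. smult (z m / d m) (l m))"
  have d: "d m \<noteq> 0" if "m \<in> A" for m
    using that inj A by (auto simp: d_def inj_on_def)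
  have "degree (l m) \<le> n - 1" if "m \<in> A" for m
  proof -
    have "degree (l m) \<le> sum (degree \<circ> (\<lambda>j. [:- x j, 1:])) (A-{m})"
      unfolding l_def by (rule degree_prod_sum_le) (use A in simp)
    also have "\<dots> = n - 1" using that A by simp
    finally show ?thesis .
  qed
  then have dq: "degree q \<le> n - 1"
    unfolding q_def by (intro degree_sum_le A order_trans[OF degree_smult_le]) auto
  have dp: "degree p \<le> n - 1"
    unfolding p_def by (intro degree_sum_le order_trans[OF degree_monom_le]) auto
  have "p = q"
  proof (rule poly_eqI_degree)
    fix c assume "c \<in> x ` A"
    then obtain m where m: "m \<in> A" "c = x m" by auto
    have "poly (l m') (x m) = (if m' = m then d m else 0)" if "m' \<in> A" for m'
      using that m A by (auto simp: l_def d_def poly_prod intro!: prod.cong)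
    then have "poly q (x m) = (\<Sum>m'\<in>A. if m' = m then z m else 0)"
      unfolding q_def poly_sum by (intro sum.cong refl) (use d in auto)
    also have "\<dots> = z m" using m A by simp
    finally show "poly p c = poly q c"
      using z[OF m(1)] m(2) by (simp add: p_def poly_sum poly_monom)
  qed (use dp dq i inj A in \<open>simp_all add: card_image\<close>)
  moreover have "coeff p i = w i"
    using i by (simp add: p_def coeff_sum)
  moreover have "coeff q i = (\<Sum>m\<in>A. z m * (coeff (l m) i / d m))"
    by (simp add: q_def coeff_sum)
  ultimately show ?thesis unfolding l_def d_def by simp
qed

text \<open>These coefficients are integer polynomials in the roots. The lemma serves both for
  passing to the fraction field and for specializing variables.\<close>

lemma hom_coeff_prod_linear:
  fixes h :: "'a::comm_ring_1 \<Rightarrow> 'b::comm_ring_1"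
  assumes "\<And>a b. h (a + b) = h a + h b" "\<And>a b. h (a * b) = h a * h b" "h 0 = 0" "h 1 = 1"
    and "finite A"
  shows "h (coeff (\<Prod>m\<in>A. [:- a m, 1:]) i) = coeff (\<Prod>m\<in>A. [:- h (a m), 1:]) i"
  using \<open>finite A\<close>
proof (induction A arbitrary: i)
  case (insert m A)
  have "h (- a m) = - h (a m)"
    using assms(1)[of "- a m" "a m"] assms(3) by (simp add: eq_neg_iff_add_eq_0)
  moreover have "h (a - b) = h a - h b" for a b
    using assms(1)[of "a - b" b] by (simp add: eq_diff_eq)
  ultimately show ?case
    using insert by (simp add: assms coeff_pCons minus_mult_left[symmetric] mult_minus_left[symmetric]
      del: mult_minus_left split: nat.split)
qed (simp add: assms coeff_1)

text \<open>In the product rule the term keeping the factor that vanishes at \<open>x p\<close>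
  drops out. What remains is the denominator of a Lagrange coefficient.\<close>

lemma poly_pderiv_prod_linear:
  fixes x :: "'a \<Rightarrow> 'b::idom"
  assumes "finite A" "p \<in> A"
  shows "poly (pderiv (\<Prod>j\<in>A. [:- x j, 1:])) (x p) = (\<Prod>j\<in>A-{p}. x p - x j)"
proof -
  have "(\<Prod>j\<in>A. [:- x j, 1:]) = [:- x p, 1:] * (\<Prod>j\<in>A-{p}. [:- x j, 1:])"
    by (rule prod.remove[OF assms])
  then show ?thesis by (simp only: pderiv_mult) (simp add: poly_prod pderiv_pCons)
qed

text \<open>Coefficients of \<open>S / (X - a)\<close> obey the recursion of synthetic division,
  hence are polynomials in the root \<open>a\<close> over the field of the coefficients of \<open>S\<close>.\<close>

lemma coeff_prod_linear_remove:
  fixes x :: "'a \<Rightarrow> 'b::idom"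
  assumes "finite A" "p \<in> A"
  shows "coeff (\<Prod>j\<in>A-{p}. [:- x j, 1:]) i =
    coeff (\<Prod>j\<in>A. [:- x j, 1:]) (Suc i) + x p * coeff (\<Prod>j\<in>A-{p}. [:- x j, 1:]) (Suc i)"
proof -
  have "(\<Prod>j\<in>A. [:- x j, 1:]) = [:- x p, 1:] * (\<Prod>j\<in>A-{p}. [:- x j, 1:])"
    by (rule prod.remove[OF assms])
  then show ?thesis by simp
qed

section \<open>Polynomials with coefficients in an adjoined subfield\<close>

definition poly_over :: "'a::zero set \<Rightarrow> 'a poly \<Rightarrow> bool" where
  "poly_over M p \<longleftrightarrow> (\<forall>j. coeff p j \<in> M)"

lemma adjoin_diff: "a \<in> adjoin F S \<Longrightarrow> b \<in> adjoin F S \<Longrightarrow> a - b \<in> adjoin F S"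
  using adjoin_closed(3)[where a = a and b = "- b"] adjoin_closed(5)[where a = b] by simp

lemma adjoin_divide: "a \<in> adjoin F S \<Longrightarrow> b \<in> adjoin F S \<Longrightarrow> a / b \<in> adjoin F S"
  by (simp add: adjoin_closed divide_inverse)

lemma adjoin_of_nat: "(of_nat m :: 'k::field ratfun) \<in> adjoin F S"
  by (induction m) (auto intro: adjoin_closed)

lemma adjoin_power: "a \<in> adjoin F S \<Longrightarrow> a ^ m \<in> adjoin F S"
  by (induction m) (auto intro: adjoin_closed)

lemma poly_over_intros:
  "poly_over (adjoin F S) 0"
  "a \<in> adjoin F S \<Longrightarrow> poly_over (adjoin F S) p \<Longrightarrow> poly_over (adjoin F S) (pCons a p)"
  "a \<in> adjoin F S \<Longrightarrow> poly_over (adjoin F S) (monom a m)"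
  "poly_over (adjoin F S) p \<Longrightarrow> poly_over (adjoin F S) q \<Longrightarrow> poly_over (adjoin F S) (p + q)"
  "poly_over (adjoin F S) p \<Longrightarrow> poly_over (adjoin F S) q \<Longrightarrow> poly_over (adjoin F S) (p - q)"
  "poly_over (adjoin F S) p \<Longrightarrow> poly_over (adjoin F S) q \<Longrightarrow> poly_over (adjoin F S) (p * q)"
  "a \<in> adjoin F S \<Longrightarrow> poly_over (adjoin F S) p \<Longrightarrow> poly_over (adjoin F S) (smult a p)"
  "poly_over (adjoin F S) p \<Longrightarrow> poly_over (adjoin F S) (pderiv p)"
proof -
  show "poly_over (adjoin F S) p \<Longrightarrow> poly_over (adjoin F S) q \<Longrightarrow> poly_over (adjoin F S) (p * q)"
    unfolding poly_over_def coeff_mult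
    by (intro allI adjoin_sum adjoin_closed) auto
qed (auto simp: poly_over_def coeff_pCons coeff_pderiv simp del: of_nat_Suc
    intro: adjoin_closed adjoin_diff adjoin_of_nat split: nat.split)

lemma poly_over_pcompose:
  "poly_over (adjoin F S) p \<Longrightarrow> poly_over (adjoin F S) q \<Longrightarrow> poly_over (adjoin F S) (pcompose p q)"
proof (induction p)
  case (pCons a p)
  have "a \<in> adjoin F S" "poly_over (adjoin F S) p"
    using pCons.prems(1) unfolding poly_over_def by (force simp: coeff_pCons split: nat.splits)+
  with pCons show ?case
    by (auto simp: pcompose_pCons intro!: poly_over_intros)
qed (simp add: poly_over_intros)

text \<open>Division with remainder, one leading term at a time, so that every coefficient visibly
  stays in the subfield; induction on the degree handles the remainder.\<close>

lemma minimal_polynomial_dvd: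
  assumes P: "poly_over (adjoin F S) P" "poly P a = 0" "P \<noteq> 0"
    and min: "\<And>Q. poly_over (adjoin F S) Q \<Longrightarrow> poly Q a = 0 \<Longrightarrow> Q \<noteq> 0 \<Longrightarrow> degree P \<le> degree Q"
    and Q: "poly_over (adjoin F S) Q" "poly Q a = 0"
  shows "P dvd Q"
  using Q
proof (induction "degree Q" arbitrary: Q rule: less_induct)
  case less
  show ?case
  proof (cases "Q = 0")
    case False
    then have le: "degree P \<le> degree Q" using min less.prems by blast
    \<comment> \<open>A positive degree makes the later drop in degree strict even if
      \<open>R = 0\<close>, whose degree is 0 by convention.\<close>
    have "degree P \<noteq> 0"
    proof
      assume "degree P = 0"
      then obtain c where "P = [:c:]" by (rule degree_eq_zeroE)
      with P show False by simp
    qed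
    define D where "D = monom (lead_coeff Q / lead_coeff P) (degree Q - degree P)"
    define R where "R = Q - D * P"
    have "D \<noteq> 0" and dD: "degree D = degree Q - degree P"
      using False P(3) by (simp_all add: D_def degree_monom_eq)
    then have dDP: "degree (D * P) = degree Q"
      using P(3) le by (simp add: degree_mult_eq)
    have "lead_coeff D = lead_coeff Q / lead_coeff P"
      unfolding dD by (simp add: D_def)
    then have "lead_coeff (D * P) = lead_coeff Q"
      unfolding lead_coeff_mult using P(3) by simp
    then have "coeff R (degree Q) = 0"
      using dDP by (simp add: R_def)
    moreover have "degree R \<le> degree Q"
      unfolding R_def using degree_diff_le[of Q "degree Q" "D * P"] dDP by simp
    ultimately have lt: "degree R < degree Q"
      using \<open>degree P \<noteq> 0\<close> le
      by (metis degree_0 gr_zeroI le_neq_implies_less le_zero_eq leading_coeff_0_iff)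
    have "poly_over (adjoin F S) R"
      using less.prems P unfolding R_def D_def
      by (intro poly_over_intros adjoin_divide) (auto simp: poly_over_def)
    moreover have "poly R a = 0"
      using less.prems P by (simp add: R_def)
    ultimately have "P dvd R" using less.hyps lt by blast
    then show ?thesis
      unfolding R_def by (metis diff_add_cancel dvd_add dvd_triv_right)
  qed simp
qed

text \<open>A polynomial \<open>P\<close> of least degree over the subfield with root
  \<open>z a\<close> divides the full product and every \<open>Q\<close>. Hence no other
  \<open>z b\<close> is a root of \<open>P\<close>; cancelling those factors leaves \<open>P\<close>
  linear, and \<open>z a\<close> is a quotient of its coefficients. The separating \<open>Q\<close>
  may vary with \<open>b\<close>.\<close>

lemma isolated_root_mem:
  assumes B: "finite B" "a \<in> B" and T: "poly_over (adjoin F S) (\<Prod>b\<in>B. [:- z b, 1:])"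
    and Q: "\<And>b. b \<in> B - {a} \<Longrightarrow>
      \<exists>Q. poly_over (adjoin F S) Q \<and> poly Q (z a) = 0 \<and> poly Q (z b) \<noteq> 0"
  shows "z a \<in> adjoin F S"
proof -
  define T where "T = (\<Prod>b\<in>B. [:- z b, 1:])"
  define good where "good P \<longleftrightarrow> poly_over (adjoin F S) P \<and> poly P (z a) = 0 \<and> P \<noteq> 0" for P
  have "T \<noteq> 0" using B by (simp add: T_def)
  moreover have Ta: "poly T (z a) = 0" using B by (auto simp: T_def poly_prod)
  ultimately have "good T" using T by (simp add: good_def T_def)
  then obtain P where P: "good P" and min: "\<And>Q. good Q \<Longrightarrow> degree P \<le> degree Q"
    using arg_min_natI[of good T degree] arg_min_nat_le[of good _ degree] by metis
  have dvd: "P dvd Q" if "poly_over (adjoin F S) Q" "poly Q (z a) = 0" for Q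
    using minimal_polynomial_dvd[where P = P and a = "z a" and Q = Q] P min that by (auto simp: good_def)
  have "P dvd T" using dvd T Ta by (simp add: T_def)
  moreover have "T = (\<Prod>b\<in>B-{a}. [:- z b, 1:]) * [:- z a, 1:]"
    unfolding T_def by (subst prod.remove[OF B]) (rule mult.commute)
  moreover have "poly P (z b) \<noteq> 0" if b: "b \<in> B - {a}" for b
  proof
    assume "poly P (z b) = 0"
    moreover obtain Q where "poly_over (adjoin F S) Q" "poly Q (z a) = 0" "poly Q (z b) \<noteq> 0"
      using Q[OF b] by blast
    ultimately show False using dvd[of Q] by (auto elim: dvdE)
  qed
  ultimately have "P dvd [:- z a, 1:]"
    using B by (metis dvd_cancel_linear_factors finite_Diff)
  then have "degree P \<le> degree [:- z a, 1:]" by (rule dvd_imp_degree_le) simp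
  then have "degree P \<le> 1" by simp
  then have "P = [:coeff P 0, coeff P 1:]"
    by (intro poly_eqI) (simp add: coeff_pCons coeff_eq_0 split: nat.split)
  then obtain c d where "P = [:c, d:]" by blast
  with P have "c + z a * d = 0" "c \<noteq> 0 \<or> d \<noteq> 0"
    by (auto simp: good_def)
  then have "d \<noteq> 0" by auto
  moreover from this have "z a = - c / d"
    using \<open>c + z a * d = 0\<close> by (metis add.inverse_unique nonzero_eq_divide_eq)
  moreover have "coeff P 0 \<in> adjoin F S" "coeff P 1 \<in> adjoin F S"
    using P by (auto simp: good_def poly_over_def)
  then have "c \<in> adjoin F S" "d \<in> adjoin F S" unfolding \<open>P = [:c, d:]\<close> by simp_all
  ultimately show ?thesis by (simp add: adjoin_divide adjoin_closed)
qed

subsection \<open>Substitution homomorphisms\<close>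

type_synonym 'k mpoly = "(nat \<Rightarrow>\<^sub>0 nat) \<Rightarrow>\<^sub>0 'k"

definition mvar :: "nat \<Rightarrow> 'k::field mpoly" where
  "mvar v = Poly_Mapping.single (Poly_Mapping.single v 1) 1"

abbreviation mconst :: "'k::field \<Rightarrow> 'k mpoly" where
  "mconst c \<equiv> Poly_Mapping.single 0 c"

lemma sum_single_lookup:
  "(\<Sum>m\<in>Poly_Mapping.keys p. Poly_Mapping.single m (Poly_Mapping.lookup p m)) = p"
proof (rule poly_mapping_eqI)
  fix m
  have "Poly_Mapping.lookup (\<Sum>m\<in>Poly_Mapping.keys p. Poly_Mapping.single m (Poly_Mapping.lookup p m)) m =
    (\<Sum>m'\<in>Poly_Mapping.keys p. if m' = m then Poly_Mapping.lookup p m' else 0)"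
    unfolding lookup_sum by (intro sum.cong) (auto simp: lookup_single when_def)
  then show "Poly_Mapping.lookup (\<Sum>m\<in>Poly_Mapping.keys p. Poly_Mapping.single m (Poly_Mapping.lookup p m)) m
      = Poly_Mapping.lookup p m"
    by (simp add: in_keys_iff)
qed

text \<open>Every element is a finite sum of monomials, and a monomial with coefficient 0 covers the
  empty sum.\<close>

lemma poly_mapping_add_induct [case_names single add]:
  fixes p :: "'a \<Rightarrow>\<^sub>0 'b::comm_monoid_add"
  assumes "\<And>m c. P (Poly_Mapping.single m c)" "\<And>p q. P p \<Longrightarrow> P q \<Longrightarrow> P (p + q)"
  shows "P p"
proof -
  have "P 0" using assms(1)[of undefined 0] by simp
  then have "P (\<Sum>m\<in>A. Poly_Mapping.single m (Poly_Mapping.lookup p m))" for A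
    by (induction A rule: infinite_finite_induct) (auto intro: assms)
  then show ?thesis using sum_single_lookup[of p] by metis
qed

text \<open>The \<open>k\<close>-algebra endomorphism of the polynomial ring that sends each
  variable \<open>v\<close> to \<open>f v\<close>, written out on monomials.\<close>

definition msubst :: "(nat \<Rightarrow> 'k mpoly) \<Rightarrow> 'k mpoly \<Rightarrow> 'k::field mpoly" where
  "msubst f p = (\<Sum>m\<in>Poly_Mapping.keys p. mconst (Poly_Mapping.lookup p m) *
      (\<Prod>v\<in>Poly_Mapping.keys m. f v ^ Poly_Mapping.lookup m v))"

text \<open>Terms outside the support contribute 0. Thus \<open>p\<close>, \<open>q\<close> and
  \<open>p + q\<close> can be summed over one index set even when terms cancel in
  \<open>p + q\<close>.\<close>

lemma msubst_superset:
  assumes "finite A" "Poly_Mapping.keys p \<subseteq> A"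
  shows "msubst f p = (\<Sum>m\<in>A. mconst (Poly_Mapping.lookup p m) *
      (\<Prod>v\<in>Poly_Mapping.keys m. f v ^ Poly_Mapping.lookup m v))"
  unfolding msubst_def using assms
  by (intro sum.mono_neutral_left) (auto simp: in_keys_iff)

lemma msubst_single:
  "msubst f (Poly_Mapping.single m c) =
     mconst c * (\<Prod>v\<in>Poly_Mapping.keys m. f v ^ Poly_Mapping.lookup m v)"
  by (subst msubst_superset[of "{m}"]) auto

lemma msubst_0 [simp]: "msubst f 0 = 0"
  by (simp add: msubst_def)

lemma msubst_const [simp]: "msubst f (mconst c) = mconst c"
  by (simp add: msubst_single)

lemma msubst_1 [simp]: "msubst f 1 = 1"
  using msubst_const[of f 1] by simp

lemma msubst_var [simp]: "msubst f (mvar v) = f v"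
  by (simp add: mvar_def msubst_single)

lemma msubst_add [simp]: "msubst f (p + q) = msubst f p + msubst f q"
proof -
  let ?A = "Poly_Mapping.keys p \<union> Poly_Mapping.keys q"
  have "msubst f r = (\<Sum>m\<in>?A. mconst (Poly_Mapping.lookup r m) *
      (\<Prod>v\<in>Poly_Mapping.keys m. f v ^ Poly_Mapping.lookup m v))"
    if "r \<in> {p, q, p + q}" for r
    using that keys_add[of p q] by (intro msubst_superset) auto
  then show ?thesis
    by (simp add: lookup_add single_add distrib_right sum.distrib)
qed

lemma msubst_uminus [simp]: "msubst f (- p) = - msubst f p"
  using msubst_add[of f "- p" p] by (simp add: eq_neg_iff_add_eq_0)

lemma msubst_diff [simp]: "msubst f (p - q) = msubst f p - msubst f q"
  using msubst_add[of f p "- q"] by simp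

text \<open>Both sides are additive in \<open>p\<close> and in \<open>q\<close>, so it suffices to
  compare single monomials, where exponents add.\<close>

lemma msubst_mult [simp]: "msubst f (p * q) = msubst f p * msubst f q"
proof (induction p rule: poly_mapping_add_induct)
  case (single m c)
  show ?case
  proof (induction q rule: poly_mapping_add_induct)
    case (single l d)
    let ?e = "\<lambda>m. \<Prod>v\<in>Poly_Mapping.keys m. f v ^ Poly_Mapping.lookup m v"
    let ?A = "Poly_Mapping.keys m \<union> Poly_Mapping.keys l"
    \<comment> \<open>Padding the three products to a common set of variables only adds factors
      \<open>f v ^ 0\<close>.\<close>
    have eq: "?e r = (\<Prod>v\<in>?A. f v ^ Poly_Mapping.lookup r v)" if "r \<in> {m, l, m + l}" for r
      using that keys_add[of m l] by (intro prod.mono_neutral_left) (auto simp: in_keys_iff)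
    have "?e (m + l) = ?e m * ?e l"
      unfolding eq[of m, simplified] eq[of l, simplified] eq[of "m + l", simplified]
      by (simp add: lookup_add power_add prod.distrib)
    moreover have "mconst (c * d) = mconst c * mconst d"
      by (simp add: mult_single)
    ultimately have "mconst (c * d) * ?e (m + l) = (mconst c * ?e m) * (mconst d * ?e l)"
      by (simp only: mult_ac)
    then show ?case
      by (simp only: mult_single[of m c l d] msubst_single)
  qed (simp_all add: distrib_left)
qed (simp_all add: distrib_right)

lemma msubst_prod: "msubst f (prod g A) = (\<Prod>a\<in>A. msubst f (g a))"
  by (induction A rule: infinite_finite_induct) auto

lemma msubst_sum: "msubst f (sum g A) = (\<Sum>a\<in>A. msubst f (g a))"
  by (induction A rule: infinite_finite_induct) auto

lemma msubst_of_nat [simp]: "msubst f (of_nat m) = of_nat m"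
  by (induction m) auto

lemma msubst_power [simp]: "msubst f (p ^ m) = msubst f p ^ m"
  by (induction m) auto

lemma mvar_pow: "mvar v ^ k = Poly_Mapping.single (Poly_Mapping.single v k) (1::'k::field)"
  by (induction k) (simp_all add: mvar_def mult_single single_add[symmetric])

lemma prod_single:
  "(\<Prod>v\<in>A. Poly_Mapping.single (g v) (1::'k::field)) = Poly_Mapping.single (\<Sum>v\<in>A. g v) 1"
  by (induction A rule: infinite_finite_induct) (simp_all add: mult_single)

lemma msubst_msubst: "msubst f (msubst g p) = msubst (\<lambda>v. msubst f (g v)) p"
  by (simp add: msubst_def[of g] msubst_def[of "\<lambda>v. msubst f (g v)"] msubst_sum msubst_prod)

lemma msubst_mvar: "msubst mvar p = p"
  unfolding msubst_def mvar_pow prod_single sum_single_lookup mult_single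
  by (simp add: sum_single_lookup)

lemma mvar_eq_iff [simp]: "(mvar u :: 'k::field mpoly) = mvar v \<longleftrightarrow> u = v"
proof
  assume "(mvar u :: 'k mpoly) = mvar v"
  then have "Poly_Mapping.keys (mvar u :: 'k mpoly) = Poly_Mapping.keys (mvar v :: 'k mpoly)" by simp
  then have "Poly_Mapping.keys (Poly_Mapping.single u (1::nat)) = Poly_Mapping.keys (Poly_Mapping.single v (1::nat))"
    by (simp add: mvar_def)
  then show "u = v" by simp
qed simp

lemma mvar_nz [simp]: "(mvar u :: 'k::field mpoly) \<noteq> 0"
proof
  assume "(mvar u :: 'k mpoly) = 0"
  then have "Poly_Mapping.lookup (mvar u :: 'k mpoly) (Poly_Mapping.single u 1) = 0" by simp
  then show False by (simp add: mvar_def)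
qed

subsection \<open>Automorphisms permuting the variables\<close>

text \<open>The extension of \<open>h\<close> to fraction fields. The description picks the common
  value over all representations of \<open>x\<close>; there is one when \<open>h\<close> is an
  injective ring homomorphism.\<close>

definition map_fract :: "('a::idom \<Rightarrow> 'b::idom) \<Rightarrow> 'a fract \<Rightarrow> 'b fract" where
  "map_fract h x = (THE y. \<exists>a b. b \<noteq> 0 \<and> x = Fract a b \<and> y = Fract (h a) (h b))"

text \<open>Injectivity is included because denominators must stay nonzero when \<open>h\<close> is
  extended to fractions.\<close>

definition ring_mono :: "('a::comm_ring_1 \<Rightarrow> 'b::comm_ring_1) \<Rightarrow> bool" where
  "ring_mono h \<longleftrightarrow>
    (\<forall>a b. h (a + b) = h a + h b) \<and> (\<forall>a b. h (a * b) = h a * h b) \<and> h 1 = 1 \<and> inj h"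

lemma ring_mono_simps:
  assumes "ring_mono h"
  shows "h (a + b) = h a + h b" "h (a * b) = h a * h b" "h 1 = 1" "h 0 = 0" "h (- a) = - h a"
    "h a = 0 \<longleftrightarrow> a = 0"
proof -
  note h = assms[unfolded ring_mono_def]
  show "h (a + b) = h a + h b" "h (a * b) = h a * h b" "h 1 = 1" using h by auto
  have "h 0 + h 0 = h 0 + 0" using h by (metis add.right_neutral)
  then show 0: "h 0 = 0" by (rule add_left_imp_eq)
  have "h (- a) + h a = 0" using h 0 by (metis ab_left_minus)
  then show "h (- a) = - h a" by (simp add: eq_neg_iff_add_eq_0)
  show "h a = 0 \<longleftrightarrow> a = 0" using h 0 by (metis injD)
qed

lemma map_fract_Fract:
  assumes h: "ring_mono h" and b: "b \<noteq> 0"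
  shows "map_fract h (Fract a b) = Fract (h a) (h b)"
  unfolding map_fract_def
proof (rule the_equality)
  fix y assume "\<exists>c d. d \<noteq> 0 \<and> Fract a b = Fract c d \<and> y = Fract (h c) (h d)"
  then obtain c d where d: "d \<noteq> 0" "Fract a b = Fract c d" "y = Fract (h c) (h d)" by blast
  then have "h (c * b) = h (a * d)" using b by (simp add: eq_fract)
  then show "y = Fract (h a) (h b)"
    using b d by (simp add: eq_fract ring_mono_simps[OF h])
qed (use b in blast)

lemma ring_mono_map_fract:
  assumes h: "ring_mono h"
  shows "ring_mono (map_fract h)"
proof -
  note * = map_fract_Fract[OF h] ring_mono_simps[OF h]
  have add: "map_fract h (x + y) = map_fract h x + map_fract h y" for x y
    by (cases x; cases y) (simp add: *)
  have mult: "map_fract h (x * y) = map_fract h x * map_fract h y" for x y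
    by (cases x; cases y) (simp add: *)
  have one: "map_fract h 1 = 1" by (simp add: One_fract_def *)
  have "x = y" if "map_fract h x = map_fract h y" for x y
  proof (cases x; cases y)
    fix a b c d assume xy: "x = Fract a b" "b \<noteq> 0" "y = Fract c d" "d \<noteq> 0"
    with that have "h (a * d) = h (c * b)" by (simp add: * eq_fract)
    moreover have "inj h" using h by (simp add: ring_mono_def)
    ultimately show ?thesis using xy by (simp add: eq_fract inj_eq)
  qed
  then show ?thesis
    unfolding ring_mono_def inj_def using add mult one by blast
qed

lemma ring_mono_inverse:
  fixes h :: "'a::field \<Rightarrow> 'b::field"
  assumes "ring_mono h"
  shows "h (inverse a) = inverse (h a)"
proof (cases "a = 0")
  case False
  then have "h (inverse a) * h a = 1"
    by (simp add: ring_mono_simps[OF assms, symmetric])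
  then show ?thesis by (metis inverse_unique mult.commute)
qed (simp add: ring_mono_simps[OF assms])

section \<open>Homomorphisms on adjoined fields and the permutations of the \<open>x\<close>
  variables\<close>

lemma adjoin_induct [consumes 1, case_names one incl uminus inverse add mult]:
  fixes a :: "'k::field ratfun"
  assumes "a \<in> adjoin F S"
    and "P 1" "\<And>a. a \<in> F \<union> S \<Longrightarrow> P a" "\<And>a. P a \<Longrightarrow> P (- a)"
    "\<And>a. P a \<Longrightarrow> a \<noteq> 0 \<Longrightarrow> P (inverse a)"
    "\<And>a b. P a \<Longrightarrow> P b \<Longrightarrow> P (a + b)" "\<And>a b. P a \<Longrightarrow> P b \<Longrightarrow> P (a * b)"
  shows "P a"
  using assms(1) unfolding adjoin_def
  by (induction rule: generate_field.induct) (auto simp: ambient_inv assms(2-))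

lemma ring_mono_adjoin_id:
  fixes h :: "'k::field ratfun \<Rightarrow> 'k ratfun"
  assumes h: "ring_mono h" and gen: "\<And>a. a \<in> F \<union> S \<Longrightarrow> h a = a" and a: "a \<in> adjoin F S"
  shows "h a = a"
  using a by (induction rule: adjoin_induct) (simp_all add: gen ring_mono_simps[OF h] ring_mono_inverse[OF h])

lemma ring_mono_adjoin_closed:
  fixes h :: "'k::field ratfun \<Rightarrow> 'k ratfun"
  assumes h: "ring_mono h" and gen: "\<And>a. a \<in> F \<union> S \<Longrightarrow> h a \<in> adjoin F' S'"
    and a: "a \<in> adjoin F S"
  shows "h a \<in> adjoin F' S'"
  using a by (induction rule: adjoin_induct)
    (simp_all add: gen ring_mono_simps[OF h] ring_mono_inverse[OF h] adjoin_closed)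

text \<open>Even indices belong to the \<open>x\<close> family, so \<open>v div 2\<close> recovers
  the number of the variable. Moving only this family is enough: every right coset of the diagonal
  subgroup has a representative fixing all \<open>y\<close> variables.\<close>

definition perm_x :: "(nat \<Rightarrow> nat) \<Rightarrow> nat \<Rightarrow> 'k::field mpoly" where
  "perm_x \<sigma> v = (if even v then mvar (2 * \<sigma> (v div 2)) else mvar v)"

definition aut_x :: "(nat \<Rightarrow> nat) \<Rightarrow> 'k::field ratfun \<Rightarrow> 'k ratfun" where
  "aut_x \<sigma> = map_fract (msubst (perm_x \<sigma>))"

text \<open>Substitution along the inverse permutation is a left inverse, which gives
  injectivity.\<close>

lemma ring_mono_msubst_perm_x:
  assumes "bij \<sigma>"
  shows "ring_mono (msubst (perm_x \<sigma>) :: 'k::field mpoly \<Rightarrow> 'k mpoly)"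
proof -
  let ?\<tau> = "inv_into UNIV \<sigma>"
  have "msubst (perm_x ?\<tau>) (msubst (perm_x \<sigma>) p) = p" for p :: "'k mpoly"
  proof -
    have "(\<lambda>v. msubst (perm_x ?\<tau>) (perm_x \<sigma> v)) = (mvar :: nat \<Rightarrow> 'k mpoly)"
      using assms by (auto simp: perm_x_def fun_eq_iff bij_is_inj)
    then show ?thesis by (simp only: msubst_msubst msubst_mvar)
  qed
  then have "inj (msubst (perm_x \<sigma>) :: 'k mpoly \<Rightarrow> 'k mpoly)" by (rule inj_on_inverseI)
  then show ?thesis by (simp add: ring_mono_def)
qed

lemma ring_mono_aut_x: "bij \<sigma> \<Longrightarrow> ring_mono (aut_x \<sigma> :: 'k::field ratfun \<Rightarrow> 'k ratfun)"
  unfolding aut_x_def by (intro ring_mono_map_fract ring_mono_msubst_perm_x)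

lemma aut_x_simps:
  assumes "bij \<sigma>"
  shows "aut_x \<sigma> (emb c) = (emb c :: 'k::field ratfun)"
    "aut_x \<sigma> (xvar j) = (xvar (\<sigma> j) :: 'k ratfun)" "aut_x \<sigma> (yvar j) = (yvar j :: 'k ratfun)"
  unfolding aut_x_def emb_def xvar_def yvar_def var_def mvar_def[symmetric]
  by (simp_all add: map_fract_Fract ring_mono_msubst_perm_x assms perm_x_def)

section \<open>Elementary symmetric functions and the Galois action\<close>

text \<open>Vieta's formula: in the expanded product, a subset \<open>A\<close> records the factors
  contributing their constant term.\<close>

lemma coeff_prod_linear_elem_sym:
  fixes z :: "nat \<Rightarrow> 'a::comm_ring_1"
  assumes "m \<le> n"
  shows "coeff (\<Prod>j\<in>{1..n}. [:- z j, 1:]) m = (-1) ^ (n - m) * elem_sym n z (n - m)"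
proof -
  have const: "(\<Prod>j\<in>A. [:- z j:]) = [:(-1) ^ card A * prod z A:]" for A
    by (induction A rule: infinite_finite_induct) (auto simp: one_pCons)
  have "(\<Prod>j\<in>{1..n}. [:- z j, 1:]) = (\<Prod>j\<in>{1..n}. [:- z j:] + monom 1 1)"
    by (simp add: monom_altdef)
  also have "\<dots> = (\<Sum>A\<in>Pow {1..n}. monom ((-1) ^ card A * prod z A) (n - card A))"
    by (subst prod_add)
      (auto intro!: sum.cong simp: const monom_power card_Diff_subset finite_subset smult_monom)
  finally have "coeff (\<Prod>j\<in>{1..n}. [:- z j, 1:]) m =
      (\<Sum>A\<in>Pow {1..n}. if n - card A = m then (-1) ^ card A * prod z A else 0)"
    by (simp add: coeff_sum)
  also have "\<dots> = (\<Sum>A | A \<subseteq> {1..n} \<and> card A = n - m. (-1) ^ card A * prod z A)"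
  proof (rule sum.mono_neutral_cong_right)
    have "card A \<le> n" if "A \<subseteq> {1..n}" for A
      using card_mono[OF _ that] by simp
    then have "n - card A = m \<longleftrightarrow> card A = n - m" if "A \<subseteq> {1..n}" for A
      using that assms by fastforce
    then show "\<forall>A\<in>Pow {1..n} - {A. A \<subseteq> {1..n} \<and> card A = n - m}.
        (if n - card A = m then (-1) ^ card A * prod z A else 0) = 0"
      by auto
  qed (use assms in auto)
  also have "\<dots> = (-1) ^ (n - m) * elem_sym n z (n - m)"
    by (simp add: elem_sym_def sum_distrib_left)
  finally show ?thesis .
qed

lemma elem_sym_1: "elem_sym n z 1 = (\<Sum>j\<in>{1..n}. z j)"
proof -
  have "{A. A \<subseteq> {1..n} \<and> card A = 1} = (\<lambda>j. {j}) ` {1..n}"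
    by (auto simp: card_1_singleton_iff)
  then show ?thesis by (simp add: elem_sym_def sum.reindex)
qed

lemma ring_mono_sum: "ring_mono h \<Longrightarrow> h (sum f A) = (\<Sum>a\<in>A. h (f a))"
  by (induction A rule: infinite_finite_induct) (simp_all add: ring_mono_simps)

lemma ring_mono_prod: "ring_mono h \<Longrightarrow> h (prod f A) = (\<Prod>a\<in>A. h (f a))"
  by (induction A rule: infinite_finite_induct) (simp_all add: ring_mono_simps)

lemma ring_mono_power: "ring_mono h \<Longrightarrow> h (a ^ m) = h a ^ m"
  by (induction m) (simp_all add: ring_mono_simps)

lemma ring_mono_compose:
  assumes "ring_mono g" "ring_mono h"
  shows "ring_mono (\<lambda>a. g (h a))"
  using inj_compose[of g h] assms
  unfolding ring_mono_def[of "\<lambda>a. g (h a)"]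
  by (auto simp: ring_mono_simps ring_mono_def[THEN iffD1] o_def)

lemma elem_sym_permute:
  assumes "\<sigma> permutes {1..n}"
  shows "elem_sym n (\<lambda>j. z (\<sigma> j)) i = elem_sym n z i"
  unfolding elem_sym_def
proof (rule sum.reindex_bij_witness[where i = "\<lambda>A. inv_into UNIV \<sigma> ` A" and j = "\<lambda>A. \<sigma> ` A"])
  note inj = permutes_inj[OF assms]
  note inj' = permutes_inj[OF permutes_inv[OF assms]]
  show "inv_into UNIV \<sigma> ` \<sigma> ` A = A" for A using inj by (simp add: image_comp)
  show "\<sigma> ` inv_into UNIV \<sigma> ` A = A" for A
    using permutes_surj[OF assms] by (simp add: image_comp surj_iff)
  show "\<sigma> ` A \<in> {A. A \<subseteq> {1..n} \<and> card A = i}" if "A \<in> {A. A \<subseteq> {1..n} \<and> card A = i}" for A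
    using that image_mono[of A "{1..n}" \<sigma>] permutes_image[OF assms] inj
    by (simp add: card_image inj_on_subset)
  show "inv_into UNIV \<sigma> ` A \<in> {A. A \<subseteq> {1..n} \<and> card A = i}"
    if "A \<in> {A. A \<subseteq> {1..n} \<and> card A = i}" for A
    using that image_mono[of A "{1..n}" "inv_into UNIV \<sigma>"] permutes_image[OF permutes_inv[OF assms]] inj'
    by (simp add: card_image inj_on_subset)
  show "prod z (\<sigma> ` A) = (\<Prod>j\<in>A. z (\<sigma> j))" for A
    by (subst prod.reindex) (use inj in \<open>auto simp: inj_on_def\<close>)
qed

lemma aut_x_fixes_K_st:
  assumes \<sigma>: "\<sigma> permutes {1..n}" and a: "a \<in> K_st n"
  shows "aut_x \<sigma> a = (a :: 'k::field ratfun)"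
proof (rule ring_mono_adjoin_id[OF _ _ a[unfolded K_st_def]])
  have b: "bij \<sigma>" using \<sigma> by (rule permutes_bij)
  show h: "ring_mono (aut_x \<sigma> :: 'k ratfun \<Rightarrow> 'k ratfun)" by (rule ring_mono_aut_x[OF b])
  have "aut_x \<sigma> (elem_sym n z i) = (elem_sym n (\<lambda>j. aut_x \<sigma> (z j)) i :: 'k ratfun)" for z i
    unfolding elem_sym_def by (simp add: ring_mono_sum[OF h] ring_mono_prod[OF h])
  then show "aut_x \<sigma> c = c"
    if "c \<in> range emb \<union> (s_sym n ` {1..n} \<union> t_sym n ` {1..n})" for c :: "'k ratfun"
    using that aut_x_simps[OF b, where 'k = 'k] elem_sym_permute[OF \<sigma>, where 'a = "'k ratfun"]
    by (auto simp: s_sym_def t_sym_def)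
qed

lemma aut_x_kxy:
  assumes \<sigma>: "\<sigma> permutes {1..n}" and a: "a \<in> kxy n"
  shows "aut_x \<sigma> a \<in> (kxy n :: 'k::field ratfun set)"
  unfolding kxy_def
proof (rule ring_mono_adjoin_closed[OF _ _ a[unfolded kxy_def]])
  have b: "bij \<sigma>" using \<sigma> by (rule permutes_bij)
  show "ring_mono (aut_x \<sigma> :: 'k ratfun \<Rightarrow> 'k ratfun)" by (rule ring_mono_aut_x[OF b])
  show "aut_x \<sigma> c \<in> adjoin (range emb) (xvar ` {1..n} \<union> yvar ` {1..n})"
    if "c \<in> range emb \<union> (xvar ` {1..n} \<union> yvar ` {1..n})" for c :: "'k ratfun"
    using that aut_x_simps[OF b, where 'k = 'k] kxy_mem[where 'k = 'k] permutes_in_image[OF \<sigma>]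
    unfolding kxy_def[symmetric] by auto
qed

text \<open>It is enough to compare on the generators of \<open>kxy n\<close>. This yields the
  surjectivity required for membership in \<open>Gal n\<close>.\<close>

lemma aut_x_inverse:
  assumes \<sigma>: "\<sigma> permutes {1..n}" and a: "a \<in> kxy n"
  shows "aut_x \<sigma> (aut_x (inv_into UNIV \<sigma>) a) = (a :: 'k::field ratfun)"
proof (rule ring_mono_adjoin_id[of "\<lambda>a. aut_x \<sigma> (aut_x (inv_into UNIV \<sigma>) a)",
      OF _ _ a[unfolded kxy_def]])
  have b: "bij \<sigma>" "bij (inv_into UNIV \<sigma>)"
    using \<sigma> permutes_bij permutes_inv by blast+
  note h = b[THEN ring_mono_aut_x, where 'k = 'k]
  show "ring_mono (\<lambda>a :: 'k ratfun. aut_x \<sigma> (aut_x (inv_into UNIV \<sigma>) a))"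
    using h(1) h(2) by (rule ring_mono_compose)
  show "aut_x \<sigma> (aut_x (inv_into UNIV \<sigma>) c) = c"
    if "c \<in> range emb \<union> (xvar ` {1..n} \<union> yvar ` {1..n})" for c :: "'k ratfun"
    using that by (auto simp: aut_x_simps b permutes_inverses[OF \<sigma>])
qed

lemma aut_x_in_Gal:
  assumes \<sigma>: "\<sigma> permutes {1..n}"
  shows "restrict (aut_x \<sigma>) (kxy n) \<in> carrier (Gal n :: ('k::field ratfun \<Rightarrow> 'k ratfun) monoid)"
proof -
  have h: "ring_mono (aut_x \<sigma> :: 'k ratfun \<Rightarrow> 'k ratfun)"
    using \<sigma> permutes_bij ring_mono_aut_x by blast
  have "aut_x \<sigma> ` kxy n = (kxy n :: 'k ratfun set)"
  proof (intro equalityI subsetI)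
    fix a :: "'k ratfun" assume a: "a \<in> kxy n"
    have "aut_x (inv_into UNIV \<sigma>) a \<in> kxy n" using aut_x_kxy[OF permutes_inv[OF \<sigma>] a] .
    then show "a \<in> aut_x \<sigma> ` kxy n"
      using aut_x_inverse[OF \<sigma> a] by (metis imageI)
  qed (use aut_x_kxy[OF \<sigma>] in auto)
  moreover have "inj_on (aut_x \<sigma>) (kxy n :: 'k ratfun set)"
    using h unfolding ring_mono_def by (blast intro: inj_on_subset)
  ultimately have bij: "bij_betw (restrict (aut_x \<sigma>) (kxy n)) (kxy n) (kxy n :: 'k ratfun set)"
    by (simp add: bij_betw_def inj_on_restrict_eq)
  have C: "1 \<in> kxy n" "\<And>a b. a \<in> kxy n \<Longrightarrow> b \<in> kxy n \<Longrightarrow> a + b \<in> kxy n"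
    "\<And>a b. a \<in> kxy n \<Longrightarrow> b \<in> kxy n \<Longrightarrow> a * b \<in> (kxy n :: 'k ratfun set)"
    unfolding kxy_def by (auto intro: adjoin_closed)
  have "aut_x \<sigma> a = a" "a \<in> kxy n" if "a \<in> K_st n" for a :: "'k ratfun"
    using aut_x_fixes_K_st[OF \<sigma> that] K_st_le_kxy that by auto
  with bij show ?thesis
    using aut_x_kxy[OF \<sigma>]
    by (auto simp: Gal_def Bij_def ring_iso_def ring_hom_def C ring_mono_simps[OF h])
qed

text \<open>The coset of \<open>g\<close> contains \<open>g\<close> itself, because the identity
  lies in \<open>Hdiag n\<close>.\<close>

lemma aut_x_conjugate:
  fixes a :: "'k::field ratfun"
  assumes \<sigma>: "\<sigma> permutes {1..n}" and a: "a \<in> kxy n"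
  shows "aut_x \<sigma> a \<in> conjugates n a"
proof -
  let ?G = "Gal n :: ('k ratfun \<Rightarrow> 'k ratfun) monoid"
  interpret group ?G by (rule group_Gal)
  define g where "g = restrict (aut_x \<sigma>) (kxy n :: 'k ratfun set)"
  have g: "g \<in> carrier ?G" unfolding g_def by (rule aut_x_in_Gal[OF \<sigma>])
  have "\<one>\<^bsub>?G\<^esub> (xvar i) = xvar i" "\<one>\<^bsub>?G\<^esub> (yvar i) = yvar i" if "i \<in> {1..n}" for i
    using kxy_mem(2,3)[OF that, where 'k = 'k] by (simp_all add: Gal_def)
  then have "\<one>\<^bsub>?G\<^esub> \<in> Hdiag n"
    unfolding Hdiag_def by (auto intro!: exI[of _ id] permutes_id simp: id_def)
  then have "g \<in> Hdiag n #>\<^bsub>?G\<^esub> g"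
    using g by (force simp: r_coset_def)
  moreover have "Hdiag n #>\<^bsub>?G\<^esub> g \<in> rcosets\<^bsub>?G\<^esub> (Hdiag n)"
    using g by (auto simp: RCOSETS_def)
  moreover have "aut_x \<sigma> a = g a" using a by (simp add: g_def)
  ultimately show ?thesis unfolding conjugates_def by blast
qed

lemma conjugates_subset_kxy:
  fixes a :: "'k::field ratfun"
  assumes a: "a \<in> kxy n"
  shows "conjugates n a \<subseteq> kxy n"
proof
  fix b assume "b \<in> conjugates n a"
  let ?G = "Gal n :: ('k ratfun \<Rightarrow> 'k ratfun) monoid"
  interpret group ?G by (rule group_Gal)
  from \<open>b \<in> conjugates n a\<close> obtain g C
    where g: "b = g a" "C \<in> rcosets\<^bsub>?G\<^esub> (Hdiag n)" "g \<in> C"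
    unfolding conjugates_def by blast
  have "Hdiag n \<subseteq> carrier ?G" by (auto simp: Hdiag_def)
  then have "g \<in> carrier ?G" using g
    by (auto simp: RCOSETS_def r_coset_def)
  then show "b \<in> kxy n"
    using a g(1) by (auto simp: Gal_def Bij_def bij_betw_def)
qed

subsection \<open>Genericity of the variables\<close>

lemma xvar_to_fract: "xvar j = to_fract (mvar (2 * j))"
  and yvar_to_fract: "yvar j = to_fract (mvar (2 * j + 1))"
  by (simp_all add: xvar_def yvar_def var_def mvar_def to_fract_def)

lemma to_fract_of_nat: "to_fract (of_nat m) = of_nat m"
  by (induction m) simp_all

lemma to_fract_prod: "to_fract (prod f A) = (\<Prod>a\<in>A. to_fract (f a))"
  by (induction A rule: infinite_finite_induct) simp_all

text \<open>Setting \<open>card B - i\<close> of the variables to 1 and the others to 0 turns the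
  product into \<open>X^i (X - 1)^(card B - i)\<close>, whose \<open>i\<close>-th coefficient is 1
  or -1.\<close>

lemma coeff_prod_linear_vars_nonzero:
  assumes "finite B" "inj_on f B" "i \<le> card B"
  shows "coeff (\<Prod>m\<in>B. [:- mvar (f m), 1:]) i \<noteq> (0 :: 'k::field mpoly)"
proof
  assume 0: "coeff (\<Prod>m\<in>B. [:- mvar (f m), 1:]) i = (0 :: 'k mpoly)"
  obtain C where C: "C \<subseteq> B" "card C = card B - i"
    using obtain_subset_with_card_n[of "card B - i" B] by auto
  define g :: "nat \<Rightarrow> 'k mpoly" where "g v = (if v \<in> f ` C then 1 else 0)" for v
  have g: "g (f m) = (if m \<in> C then 1 else 0)" if "m \<in> B" for m
    using that C(1) assms(2) by (auto simp: g_def inj_on_def)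
  have "0 = msubst g (coeff (\<Prod>m\<in>B. [:- mvar (f m), 1:]) i)"
    by (simp add: 0)
  also have "\<dots> = coeff (\<Prod>m\<in>B. [:- g (f m), 1:]) i"
    by (subst hom_coeff_prod_linear[of "msubst g"]) (simp_all add: assms msubst_var)
  also have "(\<Prod>m\<in>B. [:- g (f m), 1:]) = (\<Prod>m\<in>B-C. [:- g (f m), 1:]) * (\<Prod>m\<in>C. [:- g (f m), 1:])"
    by (rule prod.subset_diff[OF C(1) assms(1)])
  also have "(\<Prod>m\<in>B-C. [:- g (f m), 1:]) = (\<Prod>m\<in>B-C. monom 1 1)"
    by (intro prod.cong) (auto simp: g monom_altdef)
  also have "(\<Prod>m\<in>C. [:- g (f m), 1:]) = (\<Prod>m\<in>C. [:- 1, 1:])"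
    using C by (intro prod.cong) (auto simp: g)
  also have "card (B - C) = i"
    using C assms by (simp add: card_Diff_subset finite_subset)
  then have "coeff ((\<Prod>m\<in>B-C. monom 1 1) * (\<Prod>m\<in>C. [:- 1, 1:])) i = coeff ([:- 1, 1:] ^ card C) 0"
    by (simp add: monom_power coeff_monom_mult)
  also have "\<dots> = (- 1 :: 'k mpoly) ^ card C"
    by (simp add: poly_0_coeff_0[symmetric])
  finally show False by simp
qed

text \<open>The \<open>c_p\<close> of the overview: the coefficient of \<open>X^i\<close> in the
  Lagrange basis polynomial that is 1 at \<open>xvar p\<close> and 0 at the other nodes.\<close>

definition lagrange_coeff :: "nat \<Rightarrow> nat \<Rightarrow> nat \<Rightarrow> 'k::field ratfun" where
  "lagrange_coeff n i p =
    coeff (\<Prod>j\<in>{1..n}-{p}. [:- xvar j, 1:]) i / (\<Prod>j\<in>{1..n}-{p}. xvar p - xvar j)"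

text \<open>Clearing denominators turns equality into \<open>N p * D q = N q * D p\<close>.
  Identifying \<open>x_p\<close> with a third variable \<open>x_j\<close> kills \<open>D p\<close>,
  but leaves \<open>N p\<close> unchanged and \<open>D q\<close> nonzero.\<close>

lemma lagrange_coeff_neq:
  assumes n: "n \<ge> 3" and i: "i < n" and pq: "p \<in> {1..n}" "q \<in> {1..n}" "p \<noteq> q"
  shows "lagrange_coeff n i p \<noteq> (lagrange_coeff n i q :: 'k::field ratfun)"
proof
  assume eq: "lagrange_coeff n i p = (lagrange_coeff n i q :: 'k ratfun)"
  define N :: "nat \<Rightarrow> 'k mpoly"
    where "N p = coeff (\<Prod>j\<in>{1..n}-{p}. [:- mvar (2 * j), 1:]) i" for p
  define D :: "nat \<Rightarrow> 'k mpoly" where "D p = (\<Prod>j\<in>{1..n}-{p}. mvar (2 * p) - mvar (2 * j))" for p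
  have lagrange_coeff: "lagrange_coeff n i p = to_fract (N p) / to_fract (D p)" for p
    unfolding lagrange_coeff_def N_def D_def
    by (subst hom_coeff_prod_linear[of to_fract]) (simp_all add: xvar_to_fract to_fract_prod)
  have "D p \<noteq> 0" for p
    by (auto simp: D_def)
  then have "to_fract (N p * D q) = to_fract (N q * D p)"
    using eq by (simp add: lagrange_coeff field_simps)
  then have eq': "N p * D q = N q * D p" unfolding to_fract_eq_iff .
  \<comment> \<open>The third index exists because \<open>n \<ge> 3\<close>.\<close>
  have "{1..n} - {p, q} \<noteq> {}"
  proof
    assume "{1..n} - {p, q} = {}"
    then have "card {1..n} \<le> card {p, q}" by (intro card_mono) auto
    then show False using n pq by simp
  qed
  then obtain j where j: "j \<in> {1..n}" "j \<noteq> p" "j \<noteq> q" by blast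
  define f :: "nat \<Rightarrow> 'k mpoly" where "f v = mvar (if v = 2 * p then 2 * j else v)" for v
  have "msubst f (D p) = 0"
    using j by (auto simp: D_def msubst_prod f_def msubst_var)
  moreover have "msubst f (N p) = N p"
    unfolding N_def
    by (subst hom_coeff_prod_linear[of "msubst f"])
      (auto simp: msubst_var f_def intro!: arg_cong2[where f = coeff] prod.cong)
  moreover have "N p \<noteq> 0"
    unfolding N_def using i pq by (intro coeff_prod_linear_vars_nonzero) (auto simp: inj_on_def)
  moreover have "msubst f (D q) \<noteq> 0"
    using j pq by (auto simp: D_def msubst_prod f_def msubst_var)
  ultimately show False
    using arg_cong[OF eq', of "msubst f"] by simp
qed

text \<open>Setting every variable except \<open>y_b\<close> to 0 turns the left side into
  \<open>- y_b^2\<close> and the right side into 0, in every characteristic.\<close>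

lemma yvar_generic:
  assumes "b \<in> {1..n}" "a \<noteq> b" "j \<noteq> b" "c \<noteq> b"
  shows "(yvar b - yvar c) * (of_nat n * yvar a - (\<Sum>m\<in>{1..n}. yvar m)) \<noteq>
    (of_nat n * yvar b - (\<Sum>m\<in>{1..n}. yvar m)) * (yvar a - (yvar j :: 'k::field ratfun))"
proof
  let ?Y = "\<lambda>m. mvar (2 * m + 1) :: 'k mpoly"
  assume "(yvar b - yvar c) * (of_nat n * yvar a - (\<Sum>m\<in>{1..n}. yvar m)) =
    (of_nat n * yvar b - (\<Sum>m\<in>{1..n}. yvar m)) * (yvar a - (yvar j :: 'k ratfun))"
  then have "to_fract ((?Y b - ?Y c) * (of_nat n * ?Y a - (\<Sum>m\<in>{1..n}. ?Y m))) =
    to_fract ((of_nat n * ?Y b - (\<Sum>m\<in>{1..n}. ?Y m)) * (?Y a - ?Y j))"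
    by (simp only: yvar_to_fract to_fract_mult to_fract_diff to_fract_of_nat to_fract_sum)
  then have eq: "(?Y b - ?Y c) * (of_nat n * ?Y a - (\<Sum>m\<in>{1..n}. ?Y m)) =
    (of_nat n * ?Y b - (\<Sum>m\<in>{1..n}. ?Y m)) * (?Y a - ?Y j)"
    unfolding to_fract_eq_iff .
  define f where "f v = (if v = 2 * b + 1 then ?Y b else 0)" for v
  have Y: "f (Suc (2 * m)) = (if m = b then ?Y b else 0)" for m
    by (auto simp: f_def)
  show False
    using arg_cong[OF eq, of "msubst f"] assms
    by (simp add: Y msubst_sum)
qed

text \<open>Setting every variable except \<open>y_1\<close> to 0 leaves \<open>y_1\<close>.\<close>

lemma sum_yvar_neq_0:
  assumes "n \<ge> 1"
  shows "(\<Sum>m\<in>{1..n}. yvar m) \<noteq> (0 :: 'k::field ratfun)"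
proof
  let ?Y = "\<lambda>m. mvar (2 * m + 1) :: 'k mpoly"
  assume "(\<Sum>m\<in>{1..n}. yvar m) = (0 :: 'k ratfun)"
  then have "to_fract (\<Sum>m\<in>{1..n}. ?Y m) = to_fract 0"
    by (simp only: yvar_to_fract to_fract_sum to_fract_0)
  then have eq: "(\<Sum>m\<in>{1..n}. ?Y m) = 0" unfolding to_fract_eq_iff .
  define f where "f v = (if v = 2 * 1 + 1 then ?Y 1 else 0)" for v :: nat
  have Y: "f (Suc (2 * m)) = (if m = 1 then ?Y 1 else 0)" for m
    by (auto simp: f_def)
  show False
    using arg_cong[OF eq, of "msubst f"] assms
    by (simp add: Y msubst_sum)
qed

lemma yvar_eq_iff: "(yvar i :: 'k::field ratfun) = yvar j \<longleftrightarrow> i = j"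
  unfolding yvar_to_fract to_fract_eq_iff mvar_eq_iff by simp

subsection \<open>Membership of the variables in the generated field\<close>

lemma poly_over_prod_linear:
  assumes "\<And>i. i \<in> {1..n} \<Longrightarrow> elem_sym n z i \<in> adjoin F S"
  shows "poly_over (adjoin F S) (\<Prod>j\<in>{1..n}. [:- z j, 1:] :: 'k::field ratfun poly)"
  unfolding poly_over_def
proof
  fix m
  \<comment> \<open>The index 0, which gives the leading coefficient 1, lies outside the range of
    the hypothesis.\<close>
  have "{A. A \<subseteq> {1..n} \<and> card A = 0} = {{}}"
    by (auto simp: card_eq_0_iff intro: finite_subset)
  then have "elem_sym n z 0 \<in> adjoin F S" by (simp add: elem_sym_def adjoin_closed)
  then have e: "elem_sym n z i \<in> adjoin F S" if "i \<le> n" for i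
    using that assms[of i] by (cases "i = 0") auto
  show "coeff (\<Prod>j\<in>{1..n}. [:- z j, 1:]) m \<in> adjoin F S"
  proof (cases "m \<le> n")
    case True
    then show ?thesis
      unfolding coeff_prod_linear_elem_sym[OF True]
      by (intro adjoin_closed(4) e adjoin_power adjoin_closed(5) adjoin_closed(2)) simp
  next
    case False
    have "degree (\<Prod>j\<in>{1..n}. [:- z j, 1:]) \<le> sum (degree \<circ> (\<lambda>j. [:- z j, 1:])) {1..n}"
      by (rule degree_prod_sum_le) simp
    with False show ?thesis by (simp add: coeff_eq_0 adjoin_closed)
  qed
qed

text \<open>Here \<open>\<delta>\<close> stands for a difference of two Lagrange coefficients. It is
  not yet known to lie in the field, so only quotients in which it cancels are used.\<close>

lemma yvar_mem:
  fixes \<delta> :: "'k::field ratfun"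
  assumes n: "n \<ge> 3" and t: "\<And>i. i \<in> {1..n} \<Longrightarrow> elem_sym n yvar i \<in> adjoin F S"
    and \<delta>: "\<delta> \<noteq> 0" "\<And>a b. a \<in> {1..n} \<Longrightarrow> b \<in> {1..n} \<Longrightarrow> \<delta> * (yvar a - yvar b) \<in> adjoin F S"
    and a: "a \<in> {1..n}"
  shows "yvar a \<in> adjoin F S"
proof (rule isolated_root_mem[OF _ a])
  let ?t = "\<Sum>m\<in>{1..n}. yvar m :: 'k ratfun"
  define e where "e a = of_nat n * yvar a - ?t" for a
  have tM: "?t \<in> adjoin F S"
    using t[of 1] n unfolding elem_sym_1 by simp
  have e: "e c \<noteq> 0" if "c \<in> {1..n}" for c
  proof -
    have "card {1..n} > card {c}" using n by simp
    then have "\<not> {1..n} \<subseteq> {c}" by (metis card_mono finite.emptyI finite.insertI not_le)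
    then obtain b where "b \<in> {1..n}" "b \<noteq> c" by blast
    \<comment> \<open>With the other three indices all equal to \<open>c\<close>, the right side of
      the inequality is 0 and \<open>e c\<close> is a factor of the left side.\<close>
    then show ?thesis
      using yvar_generic[of b n c c c, where 'k = 'k] by (auto simp: e_def)
  qed
  have "\<delta> * e a = (\<Sum>j\<in>{1..n}. \<delta> * (yvar a - yvar j))"
    by (simp add: e_def sum_distrib_left[symmetric] sum_subtractf)
  then have eM: "\<delta> * e a \<in> adjoin F S"
    using \<delta>(2)[OF a] by (auto intro: adjoin_sum)
  define T where "T = (\<Prod>j\<in>{1..n}. [:- yvar j, 1:] :: 'k ratfun poly)"
  have T_over: "poly_over (adjoin F S) T"
    unfolding T_def by (rule poly_over_prod_linear[OF t])
  then show "poly_over (adjoin F S) (\<Prod>j\<in>{1..n}. [:- yvar j, 1:] :: 'k ratfun poly)"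
    by (simp add: T_def)
  have T_root: "poly T x = 0 \<longleftrightarrow> (\<exists>c\<in>{1..n}. x = yvar c)" for x
    by (auto simp: T_def poly_prod)
  fix b assume b: "b \<in> {1..n} - {a}"
  have "card {1..n} > card {a, b}" using n b by simp
  then have "\<not> {1..n} \<subseteq> {a, b}" by (metis card_mono finite.emptyI finite.insertI not_le)
  then obtain j where j: "j \<in> {1..n}" "j \<noteq> a" "j \<noteq> b" by blast
  define \<rho> where "\<rho> = (yvar a - yvar j) / e a"
  have "\<delta> * (yvar a - yvar j) / (\<delta> * e a) = \<rho>"
    using \<delta>(1) by (simp add: \<rho>_def)
  then have \<rho>M: "\<rho> \<in> adjoin F S"
    using adjoin_divide[OF \<delta>(2)[OF a j(1)] eM] by metis
  \<comment> \<open>The affine map \<open>Y - \<rho> * (of_nat n * Y - ?t)\<close> sends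
    \<open>yvar a\<close> to the root \<open>yvar j\<close> of \<open>T\<close>, but sends
    \<open>yvar b\<close> to no root of \<open>T\<close>.\<close>
  define Q where "Q = pcompose T [:\<rho> * ?t, 1 - \<rho> * of_nat n:]"
  have Q: "poly Q x = poly T (x - \<rho> * (of_nat n * x - ?t))" for x
    unfolding Q_def poly_pcompose by (simp add: algebra_simps)
  have "poly_over (adjoin F S) Q"
    unfolding Q_def using \<rho>M tM T_over
    by (intro poly_over_pcompose poly_over_intros adjoin_closed adjoin_diff adjoin_of_nat)
  moreover have "poly Q (yvar a) = 0"
  proof -
    have "yvar a - \<rho> * (of_nat n * yvar a - ?t) = yvar j"
      using e[OF a] unfolding e_def[symmetric] by (simp add: \<rho>_def)
    then show ?thesis using j unfolding Q T_root by auto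
  qed
  moreover have "poly Q (yvar b) \<noteq> 0"
  proof
    assume "poly Q (yvar b) = 0"
    then obtain c where c: "c \<in> {1..n}" "yvar b - \<rho> * e b = yvar c"
      unfolding Q T_root e_def by blast
    then have *: "(yvar b - yvar c) * e a = e b * (yvar a - yvar j)"
      using e[OF a] by (simp add: \<rho>_def field_simps)
    show False
    \<comment> \<open>If \<open>c = b\<close>, the left side of the equation is 0 while both factors
      on the right are nonzero; otherwise genericity applies, even for \<open>c = a\<close> or
      \<open>c = j\<close>.\<close>
    proof (cases "c = b")
      case True
      then show False using * e[of b] b j by (simp add: yvar_eq_iff)
    next
      case False
      then show False
        using yvar_generic[of b n a j c] * b j unfolding e_def by auto
    qed
  qed
  ultimately show "\<exists>Q. poly_over (adjoin F S) Q \<and> poly Q (yvar a) = 0 \<and> poly Q (yvar b) \<noteq> 0"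
    by blast
qed simp

text \<open>Synthetic division, run downwards from \<open>i \<ge> n\<close>, where the coefficient
  is 0. Each step is one \<open>pCons\<close> with a coefficient of the full product, so a single
  \<open>E\<close> works for all \<open>p\<close> at once.\<close>

lemma ex_poly_coeff_prod_linear_remove:
  fixes x :: "nat \<Rightarrow> 'k::field ratfun"
  assumes S: "poly_over (adjoin F S) (\<Prod>j\<in>{1..n}. [:- x j, 1:])"
  shows "\<exists>E. poly_over (adjoin F S) E \<and>
    (\<forall>p\<in>{1..n}. poly E (x p) = coeff (\<Prod>j\<in>{1..n}-{p}. [:- x j, 1:]) i)"
proof (induction "n - i" arbitrary: i)
  case 0
  have "coeff (\<Prod>j\<in>{1..n}-{p}. [:- x j, 1:]) i = 0" if "p \<in> {1..n}" for p
  proof -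
    have "degree (\<Prod>j\<in>{1..n}-{p}. [:- x j, 1:]) \<le> sum (degree \<circ> (\<lambda>j. [:- x j, 1:])) ({1..n}-{p})"
      by (rule degree_prod_sum_le) simp
    also have "\<dots> < n" using that by simp
    finally show ?thesis using 0 by (intro coeff_eq_0) simp
  qed
  then show ?case by (intro exI[of _ 0]) (simp add: poly_over_intros)
next
  case (Suc k)
  then have "k = n - Suc i" by simp
  from Suc.hyps(1)[OF this] obtain E where E: "poly_over (adjoin F S) E"
    "\<forall>p\<in>{1..n}. poly E (x p) = coeff (\<Prod>j\<in>{1..n}-{p}. [:- x j, 1:]) (Suc i)" by blast
  let ?s = "coeff (\<Prod>j\<in>{1..n}. [:- x j, 1:]) (Suc i)"
  have "poly_over (adjoin F S) (pCons ?s E)"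
    using S E(1) by (intro poly_over_intros) (simp_all add: poly_over_def)
  moreover have "poly (pCons ?s E) (x p) = coeff (\<Prod>j\<in>{1..n}-{p}. [:- x j, 1:]) i"
    if "p \<in> {1..n}" for p
    using E(2) coeff_prod_linear_remove[of "{1..n}" p x i] that by simp
  ultimately show ?case by blast
qed

text \<open>The polynomial \<open>E - c_p S'\<close> takes the value
  \<open>(c_q - c_p) S'(x_q)\<close> at \<open>x_q\<close>. As the Lagrange coefficients are
  distinct, it separates \<open>x_p\<close> from every other root of \<open>S\<close>.\<close>

lemma xvar_mem:
  assumes n: "n \<ge> 3" and i: "i < n"
    and s: "\<And>i. i \<in> {1..n} \<Longrightarrow> elem_sym n xvar i \<in> adjoin F S"
    and p: "p \<in> {1..n}" and c: "lagrange_coeff n i p \<in> adjoin F S"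
  shows "(xvar p :: 'k::field ratfun) \<in> adjoin F S"
proof (rule isolated_root_mem[OF _ p])
  define P where "P = (\<Prod>j\<in>{1..n}. [:- xvar j, 1:] :: 'k ratfun poly)"
  have P: "poly_over (adjoin F S) P"
    unfolding P_def by (rule poly_over_prod_linear[OF s])
  then show "poly_over (adjoin F S) (\<Prod>j\<in>{1..n}. [:- xvar j, 1:] :: 'k ratfun poly)"
    by (simp add: P_def)
  obtain E where E: "poly_over (adjoin F S) E"
    "\<And>p. p \<in> {1..n} \<Longrightarrow> poly E (xvar p) =
      coeff (\<Prod>j\<in>{1..n}-{p}. [:- xvar j, 1:] :: 'k ratfun poly) i"
    using ex_poly_coeff_prod_linear_remove[OF P[unfolded P_def], of i] by blast
  have D: "poly (pderiv P) (xvar q) \<noteq> 0"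
    "poly E (xvar q) = lagrange_coeff n i q * poly (pderiv P) (xvar q)" if "q \<in> {1..n}" for q
    using that E(2)[OF that] unfolding lagrange_coeff_def P_def
    by (auto simp: poly_pderiv_prod_linear xvar_eq_iff)
  fix b assume b: "b \<in> {1..n} - {p}"
  define Q where "Q = E - smult (lagrange_coeff n i p) (pderiv P)"
  have "poly Q (xvar q) = (lagrange_coeff n i q - lagrange_coeff n i p) * poly (pderiv P) (xvar q)"
    if "q \<in> {1..n}" for q
    using D(2)[OF that] by (simp add: Q_def algebra_simps)
  then have "poly Q (xvar p) = 0" "poly Q (xvar b) \<noteq> 0"
    using p b D(1)[of b] lagrange_coeff_neq[OF n i, of b p, where 'k = 'k] by auto
  moreover have "poly_over (adjoin F S) Q"
    unfolding Q_def by (intro poly_over_intros E c P)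
  ultimately show "\<exists>Q. poly_over (adjoin F S) Q \<and> poly Q (xvar p) = 0 \<and> poly Q (xvar b) \<noteq> 0"
    by blast
qed simp

section \<open>Conjugates of \<open>u_i\<close> as linear forms, and the conclusion\<close>

text \<open>Applying \<open>\<sigma>\<close> to the defining system gives an interpolation problem
  for the images of the \<open>u_j\<close>, with value \<open>y_m\<close> at the node
  \<open>x_(\<sigma> m)\<close>.\<close>

lemma aut_x_u_coeff:
  assumes \<sigma>: "\<sigma> permutes {1..n}" and i: "i < n"
  shows "aut_x \<sigma> (u_coeff n i) = (\<Sum>m\<in>{1..n}. yvar m * lagrange_coeff n i (\<sigma> m) :: 'k::field ratfun)"
proof -
  have b: "bij \<sigma>" using \<sigma> by (rule permutes_bij)
  note h = ring_mono_aut_x[OF b, where 'k = 'k]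
  define w :: "nat \<Rightarrow> 'k ratfun" where "w j = aut_x \<sigma> (u_coeff n j)" for j
  \<comment> \<open>Relabelling the values by the inverse permutation puts the nodes back in their
    original order.\<close>
  define z :: "nat \<Rightarrow> 'k ratfun" where "z m = yvar (inv_into UNIV \<sigma> m)" for m
  have y: "yvar m = (\<Sum>j<n. w j * xvar (\<sigma> m) ^ j)" if "m \<in> {1..n}" for m
  proof -
    have "yvar m = (\<Sum>j<n. u_coeff n j * xvar m ^ j :: 'k ratfun)"
      using is_u_u_coeff[where 'a = 'k and n = n] that by (auto simp: is_u_def)
    then have "aut_x \<sigma> (yvar m) = aut_x \<sigma> (\<Sum>j<n. u_coeff n j * xvar m ^ j :: 'k ratfun)"
      by (rule arg_cong)
    then show ?thesis
      by (simp add: w_def aut_x_simps[OF b] ring_mono_sum[OF h] ring_mono_power[OF h] ring_mono_simps[OF h])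
  qed
  have z: "z m = (\<Sum>j<n. w j * xvar m ^ j)" if "m \<in> {1..n}" for m
    using y[of "inv_into UNIV \<sigma> m"] that permutes_in_image[OF permutes_inv[OF \<sigma>]]
    by (simp add: z_def permutes_inverses[OF \<sigma>])
  have "w i = (\<Sum>m\<in>{1..n}. z m * lagrange_coeff n i m)"
    unfolding lagrange_coeff_def by (rule Lagrange_interpolation_coeff[OF _ _ _ z i])
      (simp_all add: inj_on_def xvar_eq_iff)
  also have "\<dots> = (\<Sum>m\<in>{1..n}. z (\<sigma> m) * lagrange_coeff n i (\<sigma> m))"
    by (rule sum.permute[OF \<sigma>, unfolded o_def])
  also have "\<dots> = (\<Sum>m\<in>{1..n}. yvar m * lagrange_coeff n i (\<sigma> m))"
    by (simp add: z_def permutes_inverses[OF \<sigma>])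
  finally show ?thesis by (simp add: w_def)
qed

text \<open>The first transposition takes \<open>a\<close> to \<open>p\<close> and \<open>b\<close>
  to some \<open>r\<close>; the second takes \<open>r\<close> to \<open>q\<close> and fixes
  \<open>p\<close>, which differs from both.\<close>

lemma ex_permutes_two_points:
  assumes "a \<in> A" "b \<in> A" "p \<in> A" "q \<in> A" "a \<noteq> b" "p \<noteq> q"
  shows "\<exists>\<sigma>. \<sigma> permutes A \<and> \<sigma> a = p \<and> \<sigma> b = q"
proof -
  define r where "r = transpose a p b"
  have r: "r \<in> A" "r \<noteq> p" using assms by (auto simp: r_def transpose_def)
  have "(transpose r q \<circ> transpose a p) permutes A"
    using assms r by (intro permutes_compose permutes_swap_id)
  moreover have "(transpose r q \<circ> transpose a p) a = p" "(transpose r q \<circ> transpose a p) b = q"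
    using assms r by (simp_all add: r_def[symmetric] transpose_apply_other)
  ultimately show ?thesis by blast
qed

text \<open>The sums for \<open>\<sigma>\<close> and for \<open>\<sigma>\<close> preceded by the
  transposition of \<open>a\<close> and \<open>b\<close> differ only in the terms at
  \<open>a\<close> and \<open>b\<close>, where the difference factors.\<close>

lemma lagrange_coeff_diff_times_yvar_diff:
  fixes F S :: "'k::field ratfun set"
  assumes v: "\<And>\<sigma>. \<sigma> permutes {1..n} \<Longrightarrow>
      (\<Sum>m\<in>{1..n}. yvar m * lagrange_coeff n i (\<sigma> m)) \<in> adjoin F S"
    and ab: "a \<in> {1..n}" "b \<in> {1..n}" and pq: "p \<in> {1..n}" "q \<in> {1..n}"
  shows "(lagrange_coeff n i p - lagrange_coeff n i q) * (yvar a - yvar b) \<in> adjoin F S"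
proof (cases "a = b \<or> p = q")
  case True
  then show ?thesis by (auto simp: adjoin_closed)
next
  case False
  then obtain \<sigma> where \<sigma>: "\<sigma> permutes {1..n}" "\<sigma> a = p" "\<sigma> b = q"
    using ex_permutes_two_points ab pq by metis
  have \<tau>: "(\<sigma> \<circ> transpose a b) permutes {1..n}"
    using permutes_compose[OF permutes_swap_id \<sigma>(1)] ab by simp
  let ?f = "\<lambda>m. yvar m * lagrange_coeff n i (\<sigma> m) -
    yvar m * lagrange_coeff n i ((\<sigma> \<circ> transpose a b) m) :: 'k ratfun"
  have "(\<Sum>m\<in>{1..n}. ?f m) = (\<Sum>m\<in>{a, b}. ?f m)"
    using ab by (intro sum.mono_neutral_right) (auto simp: transpose_apply_other)
  also have "\<dots> = (lagrange_coeff n i p - lagrange_coeff n i q) * (yvar a - yvar b)"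
    using False \<sigma> by (simp add: algebra_simps)
  finally show ?thesis
    using adjoin_diff[OF v[OF \<sigma>(1)] v[OF \<tau>]] by (simp add: sum_subtractf)
qed

theorem proposition2p5:
  fixes n i :: nat
  assumes "n \<ge> 3" and "i \<le> n - 1"
  shows "adjoin (L_s n) (L_t n) =
         adjoin (K_st n) (conjugates n (u_coeff n i :: 'k::field ratfun))"
proof -
  define u where "u = (u_coeff n i :: 'k ratfun)"
  define M where "M = adjoin (K_st n) (conjugates n u)"
  have i: "i < n" using assms by simp
  have u: "u \<in> kxy n"
    using is_u_u_coeff[where 'a = 'k and n = n] i by (simp add: is_u_def u_def)
  note M_mem = adjoin_incl[where F = "K_st n" and S = "conjugates n u", folded M_def]
  have gen: "range emb \<subseteq> M" "s_sym n ` {1..n} \<subseteq> M" "t_sym n ` {1..n} \<subseteq> M"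
    using M_mem(1) adjoin_incl[where F = "range emb :: 'k ratfun set"
        and S = "s_sym n ` {1..n} \<union> t_sym n ` {1..n}"]
    unfolding K_st_def[symmetric] by blast+
  have K: "elem_sym n xvar j \<in> M" "elem_sym n yvar j \<in> M" if "j \<in> {1..n}" for j
    using gen(2,3) that unfolding s_sym_def t_sym_def by blast+
  have v: "(\<Sum>m\<in>{1..n}. yvar m * lagrange_coeff n i (\<sigma> m)) \<in> M" if "\<sigma> permutes {1..n}" for \<sigma>
    using aut_x_conjugate[OF that u] M_mem(2) aut_x_u_coeff[OF that i, where 'k = 'k]
    by (auto simp: u_def)
  have diff: "(lagrange_coeff n i p - lagrange_coeff n i q) * (yvar a - yvar b) \<in> M"
    if "a \<in> {1..n}" "b \<in> {1..n}" "p \<in> {1..n}" "q \<in> {1..n}" for a b p q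
    unfolding M_def by (rule lagrange_coeff_diff_times_yvar_diff[OF v[unfolded M_def] that])
  have y: "yvar a \<in> M" if "a \<in> {1..n}" for a
  proof (rule yvar_mem[OF assms(1) _ _ _ that,
      where F = "K_st n" and S = "conjugates n u", folded M_def])
    show "lagrange_coeff n i 1 - lagrange_coeff n i 2 \<noteq> (0 :: 'k ratfun)"
      using lagrange_coeff_neq[OF assms(1) i, of 1 2, where 'k = 'k] assms(1) by simp
    show "(lagrange_coeff n i 1 - lagrange_coeff n i 2) * (yvar a - yvar b) \<in> M"
      if "a \<in> {1..n}" "b \<in> {1..n}" for a b
      using diff[OF that, of 1 2] assms(1) by simp
  qed (use K in auto)
  have lagrange_diff: "lagrange_coeff n i p - lagrange_coeff n i q \<in> M"
    if "p \<in> {1..n}" "q \<in> {1..n}" for p q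
  proof -
    have 12: "1 \<in> {1..n}" "2 \<in> {1..n}" using assms(1) by auto
    \<comment> \<open>Once the \<open>y\<close> variables lie in \<open>M\<close>, the nonzero
      factor \<open>yvar 1 - yvar 2\<close> can be divided out.\<close>
    have "(lagrange_coeff n i p - lagrange_coeff n i q) * (yvar 1 - yvar 2) / (yvar 1 - yvar 2) \<in> M"
      using diff[OF 12 that] y[OF 12(1)] y[OF 12(2)]
      unfolding M_def by (intro adjoin_divide adjoin_diff)
    then show ?thesis by (simp add: yvar_eq_iff)
  qed
  have x: "xvar p \<in> M" if p: "p \<in> {1..n}" for p
  proof (rule xvar_mem[OF assms(1) i _ p,
      where F = "K_st n" and S = "conjugates n u", folded M_def])
    let ?t = "\<Sum>m\<in>{1..n}. yvar m :: 'k ratfun"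
    have "?t \<noteq> 0" using sum_yvar_neq_0[of n] assms(1) by simp
    \<comment> \<open>The numerator is \<open>c_p\<close> times the sum of the \<open>y\<close>
      variables: \<open>u_i\<close> itself, the conjugate for \<open>id\<close>, minus a combination
      of the differences already in \<open>M\<close>.\<close>
    then have eq: "lagrange_coeff n i p = ((\<Sum>m\<in>{1..n}. yvar m * lagrange_coeff n i (id m)) -
        (\<Sum>m\<in>{1..n}. yvar m * (lagrange_coeff n i m - lagrange_coeff n i p))) / ?t"
      by (simp add: sum_subtractf[symmetric] sum_distrib_right[symmetric] right_diff_distrib)
    have "(\<Sum>m\<in>{1..n}. yvar m * (lagrange_coeff n i m - lagrange_coeff n i p)) \<in> M" "?t \<in> M"
      using y lagrange_diff[OF _ p] unfolding M_def by (auto intro!: adjoin_sum adjoin_closed(4))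
    then show "lagrange_coeff n i p \<in> M"
      using v[OF permutes_id] unfolding M_def
      by (subst eq) (intro adjoin_divide adjoin_diff)
  qed (use K in auto)
  \<comment> \<open>Since the compositum equals \<open>kxy n\<close>, it remains to compare
    generators in both directions.\<close>
  have "kxy n \<subseteq> M"
    unfolding kxy_def M_def by (rule adjoin_least, fold M_def) (use gen(1) x y in auto)
  moreover have "M \<subseteq> kxy n"
    using K_st_le_kxy conjugates_subset_kxy[OF u]
    unfolding M_def kxy_def by (intro adjoin_least Un_least)
  ultimately show ?thesis
    unfolding compositum_eq_kxy M_def u_def by blast
qed

end
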